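(* Let $0<c<1\le C<\infty$, let $f_n:[t_0,t_1]\to(0,\infty)$ ($n\in\mathbb{N}$) be a sequence of bounded, measurable functions, let $C_n>0$ be a sequence with $C_n\to0$ as $n\to\infty$, and let $Q_n\subset[t_0,t_1]$ be a dense countable family of subsets with respect to $(C_n)$, i.e. for every $n$ and every $x\in[t_0,t_1]$ there exists $y\in Q_n$ with $|x-y|\le C_n$. Suppose that for every $n$ $$f_n(q)\le C\quad\forall q\in Q_n,\qquad f_n(x)\ge c\quad\forall x\in[t_0,t_1].$$ Then, for every $n$, $d_{f_n}$ satisfies the almost Lipschitz bounds $$c\,d(p,q)\le d_{f_n}(p,q)\le\sqrt2\,C\,d(p,q)+2C_n\quad\text{for all }p,q\in M,$$ and a subsequence of $d_{f_n}$ converges uniformly to a metric $d_\infty$ on $M$ which induces the same topology as the metrics $d_{f_n}$ of the sequence and satisfies $$c\,d(p,q)\le d_\infty(p,q)\le\sqrt2\,C\,d(p,q)\quad\text{for all }p,q\in M.$$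
   Context: Setting: $t_0<t_1$ are real numbers, $(\Sigma,\sigma)$ is a smooth, compact, connected Riemannian manifold with Riemannian distance function $d_\sigma$, and $M=[t_0,t_1]\times\Sigma$. A point $p\in M$ is written $p=(x(p),p_\Sigma)$ with $x(p)\in[t_0,t_1]$, $p_\Sigma\in\Sigma$. For a bounded, measurable $f:[t_0,t_1]\to(0,\infty)$ and a piecewise smooth curve $\gamma:[0,1]\to M$, $\gamma(t)=(x(t),\alpha(t))$, put $$L_f(\gamma)=\int_0^1\sqrt{x'(t)^2+f(x(t))^2\,\sigma(\alpha'(t),\alpha'(t))}\,dt,$$ $$d_f(p,q)=\inf\{L_f(\gamma):\gamma\text{ piecewise smooth},\ \gamma(0)=p,\ \gamma(1)=q\}.$$ The reference metric on $M$ is $d(p,q)=\sqrt{|x(q)-x(p)|^2+d_\sigma(p_\Sigma,q_\Sigma)^2}$ (equal to $d_f$ with $f\equiv1$). Metrics $d_j$ on $M$ converge uniformly to $d_0$ if $\sup_{p,q\in M}|d_j(p,q)-d_0(p,q)|\to0$. The sets in a "dense countable family of subsets" are not required to be countable; the term means exactly the property spelled out in the claim. *)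

theory Defs
  imports "HOL-Analysis.Analysis"
begin

section \<open>Smooth maps\<close>

text \<open>
  All derivatives are taken within \<open>S\<close>. The predicate is used for open sets \<open>S\<close> of a
  finite-dimensional space and for relatively open subsets \<open>S\<close> of a nondegenerate compact
  interval; in both cases the derivative is unique, and at an endpoint of the interval it is the
  one-sided one. In finite dimensions, \<open>C\<^sup>k\<close> with \<open>k > 0\<close> means differentiable with all directional
  derivatives \<open>C\<^sup>k\<^sup>-\<^sup>1\<close>.
\<close>

primrec Ck_on :: "nat \<Rightarrow> 'a::real_normed_vector set \<Rightarrow> ('a \<Rightarrow> 'b::real_normed_vector) \<Rightarrow> bool" where
  "Ck_on 0 S f \<longleftrightarrow> continuous_on S f"
| "Ck_on (Suc k) S f \<longleftrightarrow> f differentiable_on S \<and>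
     (\<forall>v. Ck_on k S (\<lambda>x. frechet_derivative f (at x within S) v))"

definition smooth_on :: "'a::real_normed_vector set \<Rightarrow> ('a \<Rightarrow> 'b::real_normed_vector) \<Rightarrow> bool" where
  "smooth_on S f \<longleftrightarrow> (\<forall>k. Ck_on k S f)"


section \<open>Riemannian manifolds\<close>

text \<open>A chart \<open>(U, \<phi>)\<close> consists of its domain and its coordinate map; \<open>\<phi>\<close> is junk outside \<open>U\<close>.\<close>

type_synonym ('a, 'b) chart = "'a set \<times> ('a \<Rightarrow> 'b)"

definition transition :: "('a, 'b) chart \<Rightarrow> ('a, 'b) chart \<Rightarrow> 'b \<Rightarrow> 'b" where
  "transition c c' = snd c' \<circ> inv_into (fst c) (snd c)"

text \<open>
  A smooth manifold without boundary, modelled on a finite-dimensional space \<open>'b\<close>. The class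
  \<^class>\<open>euclidean_space\<close> is not used for \<open>'b\<close> because it excludes dimension 0. The atlas need not
  be maximal.
\<close>

locale smooth_manifold =
  fixes X :: "'a topology" and A :: "('a, 'b::real_inner) chart set"
  assumes finite_dim: "\<exists>B::'b set. finite B \<and> span B = UNIV"
    and Hausdorff: "Hausdorff_space X"
    and second_countable: "second_countable X"
    and chart_domain: "\<And>U \<phi>. (U, \<phi>) \<in> A \<Longrightarrow> openin X U"
    and chart_image: "\<And>U \<phi>. (U, \<phi>) \<in> A \<Longrightarrow> open (\<phi> ` U)"
    and chart_homeomorphic: "\<And>U \<phi>. (U, \<phi>) \<in> A \<Longrightarrow>
      homeomorphic_map (subtopology X U) (top_of_set (\<phi> ` U)) \<phi>"
    and charts_cover: "(\<Union>c\<in>A. fst c) = topspace X"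
    and charts_compatible: "\<And>U \<phi> V \<psi>. (U, \<phi>) \<in> A \<Longrightarrow> (V, \<psi>) \<in> A \<Longrightarrow>
      smooth_on (\<phi> ` (U \<inter> V)) (transition (U, \<phi>) (V, \<psi>))"

text \<open>
  A Riemannian metric is given by its coordinate representations: \<open>\<sigma> (U, \<phi>) p\<close> is the inner product
  on the tangent space at \<open>p \<in> U\<close>, expressed in the coordinates \<open>\<phi>\<close>. Representations in different
  charts are related by the transformation law of covariant 2-tensors.
\<close>

locale riemannian_manifold = smooth_manifold X A
  for X :: "'a topology" and A :: "('a, 'b::real_inner) chart set" +
  fixes \<sigma> :: "('a, 'b) chart \<Rightarrow> 'a \<Rightarrow> 'b \<Rightarrow> 'b \<Rightarrow> real"
  assumes metric_bilinear: "\<And>U \<phi> p. (U, \<phi>) \<in> A \<Longrightarrow> p \<in> U \<Longrightarrow> bilinear (\<sigma> (U, \<phi>) p)"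
    and metric_sym: "\<And>U \<phi> p v w. (U, \<phi>) \<in> A \<Longrightarrow> p \<in> U \<Longrightarrow> \<sigma> (U, \<phi>) p v w = \<sigma> (U, \<phi>) p w v"
    and metric_pos: "\<And>U \<phi> p v. (U, \<phi>) \<in> A \<Longrightarrow> p \<in> U \<Longrightarrow> v \<noteq> 0 \<Longrightarrow> 0 < \<sigma> (U, \<phi>) p v v"
    and metric_smooth: "\<And>U \<phi> v w. (U, \<phi>) \<in> A \<Longrightarrow>
      smooth_on (\<phi> ` U) (\<lambda>x. \<sigma> (U, \<phi>) (inv_into U \<phi> x) v w)"
    and metric_transform: "\<And>U \<phi> V \<psi> p v w. (U, \<phi>) \<in> A \<Longrightarrow> (V, \<psi>) \<in> A \<Longrightarrow> p \<in> U \<inter> V \<Longrightarrow>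
      \<sigma> (U, \<phi>) p v w =
        \<sigma> (V, \<psi>) p (frechet_derivative (transition (U, \<phi>) (V, \<psi>)) (at (\<phi> p)) v)
                   (frechet_derivative (transition (U, \<phi>) (V, \<psi>)) (at (\<phi> p)) w)"


section \<open>Curves and the Riemannian distance\<close>

definition unit_partition :: "nat \<Rightarrow> (nat \<Rightarrow> real) \<Rightarrow> bool" where
  "unit_partition N s \<longleftrightarrow> s 0 = 0 \<and> s N = 1 \<and> (\<forall>i<N. s i < s (Suc i))"

text \<open>Smoothness on \<open>[a, b]\<close>, in charts, of a curve that is already known to be continuous.\<close>

definition smooth_curve_on ::
    "('a, 'b::real_normed_vector) chart set \<Rightarrow> real \<Rightarrow> real \<Rightarrow> (real \<Rightarrow> 'a) \<Rightarrow> bool" where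
  "smooth_curve_on A a b \<alpha> \<longleftrightarrow> (\<forall>(U, \<phi>)\<in>A. smooth_on {t \<in> {a..b}. \<alpha> t \<in> U} (\<phi> \<circ> \<alpha>))"

definition piecewise_smooth_curve ::
    "'a topology \<Rightarrow> ('a, 'b::real_normed_vector) chart set \<Rightarrow> (real \<Rightarrow> 'a) \<Rightarrow> bool" where
  "piecewise_smooth_curve X A \<alpha> \<longleftrightarrow> continuous_map (top_of_set {0..1}) X \<alpha> \<and>
     (\<exists>N s. unit_partition N s \<and> (\<forall>i<N. smooth_curve_on A (s i) (s (Suc i)) \<alpha>))"

text \<open>
  The value \<open>\<sigma>(\<alpha>'(t), \<alpha>'(t))\<close>. Wherever \<open>\<alpha>\<close> is differentiable it does not depend on the chosen
  chart around \<open>\<alpha> t\<close>; the finitely many other parameters do not affect integrals.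
\<close>

definition speed_sq :: "('a, 'b::real_normed_vector) chart set \<Rightarrow>
    (('a, 'b) chart \<Rightarrow> 'a \<Rightarrow> 'b \<Rightarrow> 'b \<Rightarrow> real) \<Rightarrow> (real \<Rightarrow> 'a) \<Rightarrow> real \<Rightarrow> real" where
  "speed_sq A \<sigma> \<alpha> t =
     (let c = (SOME c. c \<in> A \<and> \<alpha> t \<in> fst c);
          v = vector_derivative (snd c \<circ> \<alpha>) (at t within {0..1})
      in \<sigma> c (\<alpha> t) v v)"

text \<open>
  The distances below are set to 0 outside of their carriers because \<^locale>\<open>Metric_space\<close> requires
  nonnegativity on the whole type.
\<close>

definition riem_dist :: "'a topology \<Rightarrow> ('a, 'b::real_normed_vector) chart set \<Rightarrow>
    (('a, 'b) chart \<Rightarrow> 'a \<Rightarrow> 'b \<Rightarrow> 'b \<Rightarrow> real) \<Rightarrow> 'a \<Rightarrow> 'a \<Rightarrow> real" where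
  "riem_dist X A \<sigma> p q =
     (if p \<in> topspace X \<and> q \<in> topspace X
      then Inf {integral {0..1} (\<lambda>t. sqrt (speed_sq A \<sigma> \<alpha> t)) |\<alpha>.
             piecewise_smooth_curve X A \<alpha> \<and> \<alpha> 0 = p \<and> \<alpha> 1 = q}
      else 0)"


section \<open>Warped products over an interval\<close>

definition cylinder :: "real \<Rightarrow> real \<Rightarrow> 'a topology \<Rightarrow> (real \<times> 'a) set" where
  "cylinder t0 t1 X = {t0..t1} \<times> topspace X"

definition piecewise_smooth_cylinder_curve :: "real \<Rightarrow> real \<Rightarrow> 'a topology \<Rightarrow>
    ('a, 'b::real_normed_vector) chart set \<Rightarrow> (real \<Rightarrow> real \<times> 'a) \<Rightarrow> bool" where
  "piecewise_smooth_cylinder_curve t0 t1 X A \<gamma> \<longleftrightarrow>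
     continuous_map (top_of_set {0..1}) (prod_topology (top_of_set {t0..t1}) X) \<gamma> \<and>
     (\<exists>N s. unit_partition N s \<and>
        (\<forall>i<N. smooth_on {s i..s (Suc i)} (fst \<circ> \<gamma>) \<and>
               smooth_curve_on A (s i) (s (Suc i)) (snd \<circ> \<gamma>)))"

definition warped_length :: "('a, 'b::real_normed_vector) chart set \<Rightarrow>
    (('a, 'b) chart \<Rightarrow> 'a \<Rightarrow> 'b \<Rightarrow> 'b \<Rightarrow> real) \<Rightarrow> (real \<Rightarrow> real) \<Rightarrow> (real \<Rightarrow> real \<times> 'a) \<Rightarrow> real" where
  "warped_length A \<sigma> f \<gamma> = integral {0..1} (\<lambda>t.
     sqrt ((vector_derivative (fst \<circ> \<gamma>) (at t within {0..1}))\<^sup>2 +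
           (f (fst (\<gamma> t)))\<^sup>2 * speed_sq A \<sigma> (snd \<circ> \<gamma>) t))"

definition warped_dist :: "real \<Rightarrow> real \<Rightarrow> 'a topology \<Rightarrow> ('a, 'b::real_normed_vector) chart set \<Rightarrow>
    (('a, 'b) chart \<Rightarrow> 'a \<Rightarrow> 'b \<Rightarrow> 'b \<Rightarrow> real) \<Rightarrow> (real \<Rightarrow> real) \<Rightarrow>
    real \<times> 'a \<Rightarrow> real \<times> 'a \<Rightarrow> real" where
  "warped_dist t0 t1 X A \<sigma> f p q =
     (if p \<in> cylinder t0 t1 X \<and> q \<in> cylinder t0 t1 X
      then Inf {warped_length A \<sigma> f \<gamma> |\<gamma>.
             piecewise_smooth_cylinder_curve t0 t1 X A \<gamma> \<and> \<gamma> 0 = p \<and> \<gamma> 1 = q}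
      else 0)"

text \<open>The reference metric: \<^const>\<open>prod_dist\<close> is the Pythagorean combination of two distances.\<close>

definition ref_dist :: "'a topology \<Rightarrow> ('a, 'b::real_normed_vector) chart set \<Rightarrow>
    (('a, 'b) chart \<Rightarrow> 'a \<Rightarrow> 'b \<Rightarrow> 'b \<Rightarrow> real) \<Rightarrow> real \<times> 'a \<Rightarrow> real \<times> 'a \<Rightarrow> real" where
  "ref_dist X A \<sigma> = prod_dist dist (riem_dist X A \<sigma>)"

definition dense_countable_family :: "real \<Rightarrow> real \<Rightarrow> (nat \<Rightarrow> real) \<Rightarrow> (nat \<Rightarrow> real set) \<Rightarrow> bool" where
  "dense_countable_family t0 t1 \<delta> Q \<longleftrightarrow>
     (\<forall>n. Q n \<subseteq> {t0..t1}) \<and> (\<forall>n. \<forall>x\<in>{t0..t1}. \<exists>y\<in>Q n. \<bar>x - y\<bar> \<le> \<delta> n)"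

end

theory Submission
  imports Defs "HOL-Complex_Analysis.Great_Picard"
begin

text \<open>
  Every length \<open>L\<^sub>f\<close> compares with the reference metric from both sides. If \<open>f \<ge> c\<close> with \<open>c \<le> 1\<close>, the
  integrand of \<open>L\<^sub>f\<close> is at least \<open>c\<close> times the Euclidean norm of \<open>(x', |\<alpha>'|)\<close>; projecting this vector
  onto the fixed direction of \<open>(\<Delta>x, L(\<alpha>))\<close> and integrating gives \<open>L\<^sub>f \<ge> c (\<Delta>x\<^sup>2 + L(\<alpha>)\<^sup>2)\<^sup>1\<^sup>/\<^sup>2\<close>
  (\<open>warped_length_lower_bound\<close>). From above, a curve may first move vertically to a height \<open>z \<in> Q\<^sub>n\<close>
  at distance at most \<open>\<delta>\<^sub>n\<close>, where \<open>f z \<le> C\<close>, travel horizontally at that height, and then move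
  vertically again; the detour costs at most \<open>2 \<delta>\<^sub>n\<close> (\<open>warped_dist_upper\<close>).

  Hence the distances \<open>d\<^sub>n\<close> are equi-Lipschitz up to errors \<open>2 \<delta>\<^sub>n\<close> that tend to 0. This suffices for
  the argument of Arzela and Ascoli: a diagonal subsequence converges on a countable dense set of
  pairs, and finite nets turn this into a uniform Cauchy condition
  (\<open>almost_lipschitz_subsequence\<close>). The errors disappear in the limit, so the limit is squeezed
  between multiples of the reference metric and is itself a metric. Each single \<open>f\<^sub>n\<close> is bounded, and
  therefore \<open>d\<^sub>n\<close> is also bounded above by a multiple (depending on \<open>n\<close>) of the reference metric. All
  these metrics are thus Lipschitz equivalent and induce one topology.

  The reference metric enters only through three properties of the Riemannian distance on the
  compact factor, each obtained in a single chart. Nearby points have small distance, because chart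
  segments are short (\<open>nearby_points\<close>); with compactness this gives finite nets
  (\<open>ref_dist_totally_bounded\<close>), and with connectedness it shows that any two points are joined by a
  curve (\<open>points_joined_by_curve\<close>). Distinct points have positive distance, because a curve must cross
  a coordinate ball to leave it (\<open>curve_leaving_chart_ball\<close>). In the charts the metric is comparable
  with the Euclidean norm by compactness of the unit sphere (\<open>metric_locally_comparable\<close>).

  The triangle inequality for \<open>d\<^sub>f\<close> needs lengths to be additive under concatenation and invariant
  under affine reparametrization. For this the integrals have to exist. On each closed smooth piece
  the speed extends continuously to the endpoints and does not depend on the chart, so the
  integrand is bounded and measurable (\<open>warped_speed_integrable\<close>).
\<close>

section \<open>Smooth maps along affine lines\<close>

lemma frechet_derivative_cong_on:
  assumes "x \<in> S" "\<And>y. y \<in> S \<Longrightarrow> f y = g y"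
  shows "frechet_derivative f (at x within S) = frechet_derivative g (at x within S)"
proof -
  have "(f has_derivative D) (at x within S) \<longleftrightarrow> (g has_derivative D) (at x within S)" for D
    using assms has_derivative_transform[of x S f g D] has_derivative_transform[of x S g f D] by auto
  then show ?thesis by (simp add: frechet_derivative_def)
qed

lemma Ck_on_cong:
  assumes "\<And>x. x \<in> S \<Longrightarrow> f x = g x"
  shows "Ck_on k S f \<longleftrightarrow> Ck_on k S g"
  using assms
proof (induction k arbitrary: f g)
  case 0
  then show ?case by (simp cong: continuous_on_cong)
next
  case (Suc k)
  have "f differentiable_on S \<longleftrightarrow> g differentiable_on S"
    unfolding differentiable_on_def differentiable_def
    using has_derivative_transform[of _ S f g] has_derivative_transform[of _ S g f] Suc.prems
    by (simp; meson)
  moreover have "Ck_on k S (\<lambda>x. frechet_derivative f (at x within S) v) \<longleftrightarrow>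
      Ck_on k S (\<lambda>x. frechet_derivative g (at x within S) v)" for v
    using Suc.prems frechet_derivative_cong_on[of _ S f g] by (intro Suc.IH) simp
  ultimately show ?case by simp
qed

lemma smooth_on_cong:
  assumes "\<And>x. x \<in> S \<Longrightarrow> f x = g x"
  shows "smooth_on S f \<longleftrightarrow> smooth_on S g"
  unfolding smooth_on_def using Ck_on_cong[of S f g] assms by blast

lemma has_vector_derivative_of_has_derivative:
  assumes "(g has_derivative D) (at t within R)"
  shows "(g has_vector_derivative D 1) (at t within R)"
proof -
  have "D w = w *\<^sub>R D 1" for w
    using linear_cmul[OF has_derivative_linear[OF assms], of w 1] by simp
  then have "D = (\<lambda>w. w *\<^sub>R D 1)" by blast
  then show ?thesis using assms by (simp add: has_vector_derivative_def)
qed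

text \<open>
  The condition \<open>at t within R \<noteq> bot\<close> makes derivatives within \<open>R\<close> unique, so that the choice
  hidden in \<^const>\<open>frechet_derivative\<close> is forced to be the one given by the chain rule.
\<close>

lemma frechet_derivative_along_line:
  fixes F :: "'c::real_normed_vector \<Rightarrow> 'd::real_normed_vector" and R :: "real set"
  assumes F: "F differentiable (at (a + t *\<^sub>R v) within S)"
    and R: "(\<lambda>t. a + t *\<^sub>R v) ` R \<subseteq> S" "at t within R \<noteq> bot"
  shows "((\<lambda>t. F (a + t *\<^sub>R v)) has_derivative
           (\<lambda>w. frechet_derivative F (at (a + t *\<^sub>R v) within S) (w *\<^sub>R v))) (at t within R)"
    and "frechet_derivative (\<lambda>t. F (a + t *\<^sub>R v)) (at t within R) w =
           frechet_derivative F (at (a + t *\<^sub>R v) within S) (w *\<^sub>R v)"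
proof -
  let ?D = "\<lambda>w. frechet_derivative F (at (a + t *\<^sub>R v) within S) (w *\<^sub>R v)"
  have line: "((\<lambda>t. a + t *\<^sub>R v) has_derivative (\<lambda>w. w *\<^sub>R v)) (at t within R)"
    by (auto intro!: derivative_eq_intros)
  have "(F has_derivative frechet_derivative F (at (a + t *\<^sub>R v) within S))
      (at (a + t *\<^sub>R v) within (\<lambda>t. a + t *\<^sub>R v) ` R)"
    using F R(1) frechet_derivative_works has_derivative_subset by blast
  then show D: "((\<lambda>t. F (a + t *\<^sub>R v)) has_derivative ?D) (at t within R)"
    using diff_chain_within[OF line] by (simp add: o_def)
  then have D': "((\<lambda>t. F (a + t *\<^sub>R v)) has_derivative
      frechet_derivative (\<lambda>t. F (a + t *\<^sub>R v)) (at t within R)) (at t within R)"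
    using frechet_derivative_works differentiable_def by blast
  interpret D: bounded_linear ?D using D has_derivative_bounded_linear by blast
  interpret D': bounded_linear "frechet_derivative (\<lambda>t. F (a + t *\<^sub>R v)) (at t within R)"
    using D' has_derivative_bounded_linear by blast
  have "((\<lambda>t. F (a + t *\<^sub>R v)) has_vector_derivative ?D 1) (at t within R)"
    by (rule has_vector_derivative_of_has_derivative[OF D])
  moreover have "((\<lambda>t. F (a + t *\<^sub>R v)) has_vector_derivative
      frechet_derivative (\<lambda>t. F (a + t *\<^sub>R v)) (at t within R) 1) (at t within R)"
    by (rule has_vector_derivative_of_has_derivative[OF D'])
  ultimately have "frechet_derivative (\<lambda>t. F (a + t *\<^sub>R v)) (at t within R) 1 = ?D 1"
    using vector_derivative_unique_within[OF R(2)] by blast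
  then show "frechet_derivative (\<lambda>t. F (a + t *\<^sub>R v)) (at t within R) w = ?D w"
    using D'.scale[of w 1] D.scale[of w 1] by simp
qed

text \<open>
  The induction closes because the derivative along a line is a directional derivative of \<open>F\<close> in a
  fixed direction, restricted to the same line. Restriction to subintervals, affine
  reparametrization of curves and coordinate changes of chart segments are instances of this lemma.
\<close>

lemma Ck_on_along_line:
  fixes R :: "real set"
  assumes "Ck_on k S F" "(\<lambda>t. a + t *\<^sub>R v) ` R \<subseteq> S" "\<And>t. t \<in> R \<Longrightarrow> at t within R \<noteq> bot"
  shows "Ck_on k R (\<lambda>t. F (a + t *\<^sub>R v))"
  using assms
proof (induction k arbitrary: F)
  case 0
  have "continuous_on R (\<lambda>t. a + t *\<^sub>R v)" by (intro continuous_intros)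
  then show ?case using 0 by (auto intro: continuous_on_compose2)
next
  case (Suc k)
  have F: "F differentiable (at (a + t *\<^sub>R v) within S)" if "t \<in> R" for t
    using Suc.prems(1,2) that by (auto simp: differentiable_on_def)
  have "Ck_on k R (\<lambda>t. frechet_derivative (\<lambda>t. F (a + t *\<^sub>R v)) (at t within R) w)" for w
  proof -
    have "Ck_on k R (\<lambda>t. frechet_derivative F (at (a + t *\<^sub>R v) within S) (w *\<^sub>R v))"
      using Suc.prems by (intro Suc.IH) auto
    then show ?thesis
      using frechet_derivative_along_line(2)[OF F Suc.prems(2,3)] by (subst Ck_on_cong) auto
  qed
  moreover have "(\<lambda>t. F (a + t *\<^sub>R v)) differentiable_on R"
    unfolding differentiable_on_def differentiable_def
    using frechet_derivative_along_line(1)[OF F Suc.prems(2,3)] by blast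
  ultimately show ?case by simp
qed

lemma smooth_on_along_line:
  fixes R :: "real set"
  assumes "smooth_on S F" "(\<lambda>t. a + t *\<^sub>R v) ` R \<subseteq> S" "\<And>t. t \<in> R \<Longrightarrow> at t within R \<noteq> bot"
  shows "smooth_on R (\<lambda>t. F (a + t *\<^sub>R v))"
  using assms Ck_on_along_line unfolding smooth_on_def by blast

lemma smooth_on_const_UNIV: "smooth_on (UNIV :: 'c::real_normed_vector set) (\<lambda>_. y)"
proof -
  have "Ck_on k (UNIV :: 'c set) (\<lambda>_. y)" for k
  proof (induction k arbitrary: y)
    case (Suc k)
    then show ?case by (simp add: frechet_derivative_const)
  qed simp
  then show ?thesis by (simp add: smooth_on_def)
qed

lemma smooth_on_id_UNIV: "smooth_on (UNIV :: 'c::real_normed_vector set) (\<lambda>x. x)"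
proof -
  have "Ck_on k (UNIV :: 'c set) (\<lambda>x. x)" for k
    using smooth_on_const_UNIV by (cases k) (auto simp: frechet_derivative_ident smooth_on_def)
  then show ?thesis by (simp add: smooth_on_def)
qed

lemma smooth_on_const:
  fixes R :: "real set"
  assumes "\<And>t. t \<in> R \<Longrightarrow> at t within R \<noteq> bot"
  shows "smooth_on R (\<lambda>_. y)"
  using smooth_on_along_line[OF smooth_on_const_UNIV _ assms, of 0 0 y] by simp

lemma smooth_on_line:
  fixes R :: "real set"
  assumes "\<And>t. t \<in> R \<Longrightarrow> at t within R \<noteq> bot"
  shows "smooth_on R (\<lambda>t. a + t *\<^sub>R v)"
  using smooth_on_along_line[OF smooth_on_id_UNIV _ assms, of a v] by simp

lemma at_within_open_Int_interval:
  fixes a b :: real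
  assumes "open T" "t \<in> T"
  shows "at t within ({a..b} \<inter> T) = at t within {a..b}"
  using assms by (intro at_within_nhd[of t T]) auto

text \<open>
  Smoothness of a curve in a chart is tested on the parameters that the curve sends into the chart
  domain. These form a relatively open subset of a nondegenerate interval, on which differentiation
  is the same as on the whole interval and derivatives are unique.
\<close>

lemma at_within_relatively_open_nontrivial:
  fixes a b :: real
  assumes "a < b" "openin (top_of_set {a..b}) R" "t \<in> R"
  shows "at t within R = at t within {a..b}" "at t within R \<noteq> bot"
proof -
  obtain T where T: "open T" "R = {a..b} \<inter> T" using assms(2) by (auto simp: openin_open)
  show *: "at t within R = at t within {a..b}"
    unfolding T(2) using T assms(3) by (intro at_within_open_Int_interval) auto
  show "at t within R \<noteq> bot"
    unfolding * using assms T by (simp add: trivial_limit_within islimpt_Icc)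
qed

lemma smooth_on_imp_C1:
  fixes R :: "real set" and g :: "real \<Rightarrow> 'd::real_normed_vector"
  assumes "smooth_on R g" "\<And>t. t \<in> R \<Longrightarrow> at t within R \<noteq> bot"
  shows "\<And>t. t \<in> R \<Longrightarrow> (g has_vector_derivative vector_derivative g (at t within R)) (at t within R)"
    and "continuous_on R (\<lambda>t. vector_derivative g (at t within R))"
proof -
  have g: "g differentiable_on R" "continuous_on R (\<lambda>x. frechet_derivative g (at x within R) 1)"
    using assms(1)[unfolded smooth_on_def, rule_format, of 1] by auto
  show v: "(g has_vector_derivative vector_derivative g (at t within R)) (at t within R)" if "t \<in> R" for t
    using g(1) that by (auto simp: differentiable_on_def vector_derivative_works)
  have "frechet_derivative g (at t within R) 1 = vector_derivative g (at t within R)" if t: "t \<in> R" for t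
  proof -
    have D: "(g has_derivative frechet_derivative g (at t within R)) (at t within R)"
      using g(1) t by (auto simp: differentiable_on_def frechet_derivative_works)
    then have "(g has_vector_derivative frechet_derivative g (at t within R) 1) (at t within R)"
      by (rule has_vector_derivative_of_has_derivative)
    then show ?thesis using v[OF t] assms(2)[OF t] vector_derivative_unique_within by blast
  qed
  then show "continuous_on R (\<lambda>t. vector_derivative g (at t within R))"
    using g(2) by (simp cong: continuous_on_cong)
qed

section \<open>Subdivided intervals\<close>

text \<open>
  This replaces partitions \<open>s\<^sub>0 < \<dots> < s\<^sub>N\<close> of \<open>[a, b]\<close> with the property \<open>P\<close> on consecutive points.
  Piecewise statements are then proved by rule induction, and the rule \<open>join\<close> concatenates curves
  without any arithmetic on indices.
\<close>

inductive chain :: "(real \<Rightarrow> real \<Rightarrow> bool) \<Rightarrow> real \<Rightarrow> real \<Rightarrow> bool" for P where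
  piece: "a < b \<Longrightarrow> P a b \<Longrightarrow> chain P a b"
| join: "chain P a b \<Longrightarrow> chain P b c \<Longrightarrow> chain P a c"

lemma chain_less: "chain P a b \<Longrightarrow> a < b"
  by (induction rule: chain.induct) auto

lemma chain_of_partition:
  assumes "s 0 = a" "\<forall>i<N. s i < s (Suc i) \<and> P (s i) (s (Suc i))" "0 < N"
  shows "chain P a (s N)"
  using assms(3,2)
proof (induction N)
  case (Suc N)
  then have "chain P (s N) (s (Suc N))" by (simp add: chain.piece)
  then show ?case using Suc assms(1) chain.join[of P a "s N"] by (cases N) auto
qed simp

lemma partition_of_chain:
  assumes "chain P a b"
  shows "\<exists>N s. s 0 = a \<and> s N = b \<and> (\<forall>i<N. s i < s (Suc i) \<and> P (s i) (s (Suc i)))"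
  using assms
proof (induction rule: chain.induct)
  case (piece a b)
  then show ?case by (intro exI[of _ 1] exI[of _ "\<lambda>i. if i = 0 then a else b"]) auto
next
  case (join a b c)
  then obtain M r N s where r: "r 0 = a" "r M = b" "\<forall>i<M. r i < r (Suc i) \<and> P (r i) (r (Suc i))"
    and s: "s 0 = b" "s N = c" "\<forall>i<N. s i < s (Suc i) \<and> P (s i) (s (Suc i))" by blast
  define q where "q i = (if i \<le> M then r i else s (i - M))" for i
  have "q i < q (Suc i) \<and> P (q i) (q (Suc i))" if "i < M + N" for i
  proof (cases "i < M")
    case False
    then have "q i = s (i - M)" "q (Suc i) = s (Suc (i - M))"
      using r s by (auto simp: q_def Suc_diff_le)
    then show ?thesis using s(3) that False by auto
  qed (use r in \<open>simp add: q_def\<close>)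
  moreover have "q 0 = a" "q (M + N) = c" using r s by (auto simp: q_def)
  ultimately show ?case by blast
qed

lemma chain_iff_partition:
  "chain P 0 1 \<longleftrightarrow> (\<exists>N s. unit_partition N s \<and> (\<forall>i<N. P (s i) (s (Suc i))))"
proof
  assume "chain P 0 1"
  then show "\<exists>N s. unit_partition N s \<and> (\<forall>i<N. P (s i) (s (Suc i)))"
    using partition_of_chain[of P 0 1] unfolding unit_partition_def by metis
next
  assume "\<exists>N s. unit_partition N s \<and> (\<forall>i<N. P (s i) (s (Suc i)))"
  then obtain N s where "unit_partition N s" "\<forall>i<N. P (s i) (s (Suc i))" by blast
  moreover then have "0 < N" by (cases N) (auto simp: unit_partition_def)
  ultimately show "chain P 0 1"
    using chain_of_partition[of s 0 N P] by (simp add: unit_partition_def)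
qed

lemma chain_mono:
  assumes "chain P a b" "\<And>a' b'. a \<le> a' \<Longrightarrow> b' \<le> b \<Longrightarrow> a' < b' \<Longrightarrow> P a' b' \<Longrightarrow> Q a' b'"
  shows "chain Q a b"
  using assms
proof (induction rule: chain.induct)
  case (join a b c)
  have "a < b" "b < c" using join(1,2) chain_less by blast+
  then show ?case using join by (intro chain.join[of Q a b c]) auto
qed (auto intro: chain.piece)

lemma chain_affine:
  assumes "chain P a b" "m > 0" 
    and "\<And>a b. a < b \<Longrightarrow> P (m * a + k) (m * b + k) \<Longrightarrow> Q a b"
  shows "chain Q ((a - k) / m) ((b - k) / m)"
  using assms(1)
proof (induction rule: chain.induct)
  case (piece a b)
  then show ?case using assms(2,3) by (intro chain.piece) (auto simp: divide_strict_right_mono)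
qed (auto intro: chain.join)

lemma chain_reverse:
  assumes "chain P a b" "\<And>a b. a < b \<Longrightarrow> P (k - b) (k - a) \<Longrightarrow> Q a b"
  shows "chain Q (k - b) (k - a)"
  using assms(1)
proof (induction rule: chain.induct)
  case (piece a b)
  then show ?case using assms(2) by (intro chain.piece) auto
qed (auto intro: chain.join)

section \<open>Positive definite forms in finite dimension\<close>

text \<open>
  Normalizing an orthogonal spanning set is enough once 0 is discarded: pairwise orthogonal nonzero
  vectors stay distinct, and the expansion holds on the spanning set, hence everywhere.
\<close>

lemma orthonormal_basis_exists:
  assumes "finite (B :: 'b::real_inner set)" "span B = UNIV"
  shows "\<exists>E::'b set. finite E \<and> (\<forall>e\<in>E. norm e = 1) \<and> (\<forall>v. v = (\<Sum>e\<in>E. (v \<bullet> e) *\<^sub>R e))"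
proof -
  obtain C where C: "finite C" "span C = (UNIV :: 'b set)" "pairwise orthogonal C"
    using basis_orthogonal[OF assms(1)] assms(2) by auto
  let ?s = "\<lambda>v. \<Sum>c\<in>C - {0}. (v \<bullet> (c /\<^sub>R norm c)) *\<^sub>R (c /\<^sub>R norm c)"
  have lin: "linear ?s"
    by (rule linearI) (simp_all add: inner_add_left sum.distrib algebra_simps scaleR_sum_right)
  have "?s x = x" if x: "x \<in> C" for x
  proof (cases "x = 0")
    case False
    have "?s x = (\<Sum>c\<in>C - {0}. if c = x then x else 0)"
    proof (rule sum.cong[OF refl])
      fix c assume c: "c \<in> C - {0}"
      show "(x \<bullet> (c /\<^sub>R norm c)) *\<^sub>R (c /\<^sub>R norm c) = (if c = x then x else 0)"
        using c x C(3) False by (auto simp: pairwise_def orthogonal_def dot_square_norm power2_eq_square field_simps)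
    qed
    also have "\<dots> = x" using C(1) x False by simp
    finally show ?thesis .
  qed simp
  then have id: "?s v = v" for v
    using linear_eq_on_span[OF lin linear_id, of C v] C(2) by simp
  have inj: "inj_on (\<lambda>c. c /\<^sub>R norm c) (C - {0})"
  proof (rule inj_onI)
    fix x y assume xy: "x \<in> C - {0}" "y \<in> C - {0}" "x /\<^sub>R norm x = y /\<^sub>R norm y"
    show "x = y"
    proof (rule ccontr)
      assume "x \<noteq> y"
      then have "x \<bullet> y = 0" using C(3) xy by (auto simp: pairwise_def orthogonal_def)
      then have "(x /\<^sub>R norm x) \<bullet> (y /\<^sub>R norm y) = 0" by simp
      then have "x /\<^sub>R norm x = 0" using xy(3) by simp
      then show False using xy by simp
    qed
  qed
  define E where "E = (\<lambda>c. c /\<^sub>R norm c) ` (C - {0})"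
  have "v = (\<Sum>e\<in>E. (v \<bullet> e) *\<^sub>R e)" for v
    using id[of v] unfolding E_def sum.reindex[OF inj] o_def by simp
  moreover have "finite E" "\<forall>e\<in>E. norm e = 1" using C by (auto simp: E_def)
  ultimately show ?thesis by blast
qed

text \<open>
  The model space of a manifold belongs only to \<^class>\<open>real_inner\<close>, so the Heine-Borel theorem has
  to be recovered from a finite spanning set: adding one vector to it replaces the set of
  combinations by a continuous image of its product with a compact interval.
\<close>

lemma compact_box_combinations:
  assumes "finite (E :: 'b::real_normed_vector set)"
  shows "compact {\<Sum>e\<in>E. k e *\<^sub>R e |k. \<forall>e. \<bar>k e\<bar> \<le> (r::real)}"
  using assms
proof (induction rule: finite_induct)
  case empty
  have "{\<Sum>e\<in>{}. k e *\<^sub>R e |k. \<forall>e. \<bar>k e\<bar> \<le> r} \<subseteq> {0::'b}" by auto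
  then show ?case using finite_subset finite_imp_compact by blast
next
  case (insert x F)
  let ?K = "{\<Sum>e\<in>F. k e *\<^sub>R e |k. \<forall>e. \<bar>k e\<bar> \<le> r}"
  have "{\<Sum>e\<in>insert x F. k e *\<^sub>R e |k. \<forall>e. \<bar>k e\<bar> \<le> r} =
      (\<lambda>(t, y). t *\<^sub>R x + y) ` ({-r..r} \<times> ?K)" (is "?L = ?R")
  proof
    show "?L \<subseteq> ?R"
    proof
      fix y assume "y \<in> ?L"
      then obtain k where k: "y = (\<Sum>e\<in>insert x F. k e *\<^sub>R e)" "\<forall>e. \<bar>k e\<bar> \<le> r" by blast
      then have "y = k x *\<^sub>R x + (\<Sum>e\<in>F. k e *\<^sub>R e)" using insert by simp
      moreover have "k x \<in> {-r..r}" using k(2)[rule_format, of x] by auto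
      ultimately show "y \<in> ?R" using k(2) by (force intro!: image_eqI[of _ _ "(k x, \<Sum>e\<in>F. k e *\<^sub>R e)"])
    qed
    show "?R \<subseteq> ?L"
    proof
      fix y assume "y \<in> ?R"
      then obtain t k where k: "y = t *\<^sub>R x + (\<Sum>e\<in>F. k e *\<^sub>R e)" "t \<in> {-r..r}" "\<forall>e. \<bar>k e\<bar> \<le> r" by auto
      have "(\<Sum>e\<in>F. (k(x := t)) e *\<^sub>R e) = (\<Sum>e\<in>F. k e *\<^sub>R e)"
        using insert by (intro sum.cong) auto
      then have "y = (\<Sum>e\<in>insert x F. (k(x := t)) e *\<^sub>R e)" using k insert by simp
      moreover have "\<forall>e. \<bar>(k(x := t)) e\<bar> \<le> r" using k by auto
      ultimately show "y \<in> ?L" by blast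
    qed
  qed
  moreover have "compact \<dots>"
    using insert.IH by (intro compact_continuous_image compact_Times)
      (auto intro!: continuous_intros simp: case_prod_unfold)
  ultimately show ?case by simp
qed

lemma compact_cball_finite_dim:
  assumes "finite (B :: 'b::real_inner set)" "span B = UNIV"
  shows "compact (cball (a::'b) r)"
proof -
  obtain E where E: "finite E" "\<forall>e\<in>E. norm e = 1" "\<And>v::'b. v = (\<Sum>e\<in>E. (v \<bullet> e) *\<^sub>R e)"
    using orthonormal_basis_exists[OF assms] by blast
  have "cball 0 r \<subseteq> {\<Sum>e\<in>E. k e *\<^sub>R e |k. \<forall>e. \<bar>k e\<bar> \<le> r}"
  proof
    fix v :: 'b assume v: "v \<in> cball 0 r"
    let ?k = "\<lambda>e. if e \<in> E then v \<bullet> e else 0"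
    have "\<bar>?k e\<bar> \<le> r" for e
      using v Cauchy_Schwarz_ineq2[of v e] E(2) norm_ge_zero[of v]
      by (auto simp del: norm_ge_zero) 
    moreover have "v = (\<Sum>e\<in>E. ?k e *\<^sub>R e)" using E(3)[of v] by (simp cong: sum.cong)
    ultimately show "v \<in> {\<Sum>e\<in>E. k e *\<^sub>R e |k. \<forall>e. \<bar>k e\<bar> \<le> r}" by (intro CollectI exI[of _ ?k]) auto
  qed
  then have "compact (cball (0::'b) r)"
    using compact_Int_closed[OF compact_box_combinations[OF E(1), of r] closed_cball[of 0 r]]
    by (simp add: Int_absorb1)
  then have "compact ((+) a ` cball 0 r)" by (rule compact_translation)
  then show ?thesis by (simp add: image_add_cball)
qed

text \<open>
  This reduces continuity and perturbation statements about a varying bilinear form to its finitely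
  many coefficients.
\<close>

lemma bilinear_expand:
  fixes s :: "'b::real_inner \<Rightarrow> 'b \<Rightarrow> real"
  assumes "bilinear s" "\<And>v. v = (\<Sum>e\<in>E. (v \<bullet> e) *\<^sub>R e)"
  shows "s v v = (\<Sum>(d, e)\<in>E\<times>E. (v \<bullet> d) * (v \<bullet> e) * s d e)"
proof -
  have "s v v = s (\<Sum>d\<in>E. (v \<bullet> d) *\<^sub>R d) (\<Sum>e\<in>E. (v \<bullet> e) *\<^sub>R e)" using assms(2) by metis
  also have "\<dots> = (\<Sum>(d, e)\<in>E\<times>E. (v \<bullet> d) * (v \<bullet> e) * s d e)"
    by (subst bilinear_sum[OF assms(1)])
      (auto simp: bilinear_lmul[OF assms(1)] bilinear_rmul[OF assms(1)] intro!: sum.cong)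
  finally show ?thesis .
qed

text \<open>
  The constant is the minimum of the form on the compact unit sphere; homogeneity does the rest.
\<close>

lemma positive_definite_lower_bound:
  assumes fin: "finite (B :: 'b::real_inner set)" "span B = UNIV"
    and s: "bilinear s" "\<And>v::'b. v \<noteq> 0 \<Longrightarrow> (0::real) < s v v"
  shows "\<exists>l>0. \<forall>v. l * (norm v)\<^sup>2 \<le> s v v"
proof -
  obtain E where E: "finite E" "\<forall>e\<in>E. norm e = 1" "\<And>v::'b. v = (\<Sum>e\<in>E. (v \<bullet> e) *\<^sub>R e)"
    using orthonormal_basis_exists[OF fin] by blast
  note expand = bilinear_expand[OF s(1) E(3)]
  have cont: "continuous_on (sphere 0 1) (\<lambda>v. s v v)"
    unfolding expand by (intro continuous_intros) (auto simp: case_prod_unfold intro!: continuous_intros)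
  show ?thesis
  proof (cases "sphere (0::'b) 1 = {}")
    case True
    then have "v = 0" for v :: 'b using norm_sgn[of v] by (metis empty_iff mem_sphere_0 )
    then show ?thesis using bilinear_lzero[OF s(1)] by (intro exI[of _ 1]) (metis bilinear_lzero order_refl mult_zero_right norm_zero zero_less_one zero_power2)
  next
    case False
    have "compact (cball (0::'b) 1 \<inter> sphere 0 1)"
      by (intro compact_Int_closed compact_cball_finite_dim[OF fin])
        (simp add: sphere_def closed_Collect_eq continuous_intros)
    then have "compact (sphere (0::'b) 1)" by (simp add: Int_absorb1)
    then obtain w where w: "w \<in> sphere 0 1" "\<And>v. v \<in> sphere 0 1 \<Longrightarrow> s w w \<le> s v v"
      using continuous_attains_inf[OF _ False cont] by blast
    have "s w w * (norm v)\<^sup>2 \<le> s v v" for v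
    proof (cases "v = 0")
      case False
      have "s w w \<le> s (sgn v) (sgn v)" using w False by (simp add: norm_sgn)
      also have "\<dots> = s v v / (norm v)\<^sup>2"
        by (simp add: sgn_div_norm bilinear_lmul[OF s(1)] bilinear_rmul[OF s(1)] power2_eq_square field_simps)
      finally show ?thesis using False by (simp add: field_simps)
    qed (simp add: bilinear_lzero[OF s(1)])
    moreover have "0 < s w w" using w s(2) by (metis mem_sphere_0 norm_zero zero_neq_one)
    ultimately show ?thesis by blast
  qed
qed

section \<open>The speed of curves\<close>

context smooth_manifold
begin

lemma chart_facts:
  assumes "(U, \<phi>) \<in> A"
  shows chart_subset: "U \<subseteq> topspace X"
    and chart_inj: "inj_on \<phi> U"
    and chart_continuous: "continuous_map (subtopology X U) euclidean \<phi>"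
    and chart_inverse_continuous: "continuous_map (top_of_set (\<phi> ` U)) X (inv_into U \<phi>)"
proof -
  show sub: "U \<subseteq> topspace X" using chart_domain[OF assms] by (rule openin_subset)
  show inj: "inj_on \<phi> U"
    using homeomorphic_imp_injective_map[OF chart_homeomorphic[OF assms]] sub by (simp add: Int_absorb1)
  obtain g where g: "homeomorphic_maps (subtopology X U) (top_of_set (\<phi> ` U)) \<phi> g"
    using chart_homeomorphic[OF assms] homeomorphic_map_maps by blast
  show "continuous_map (subtopology X U) euclidean \<phi>"
    using g by (auto simp: homeomorphic_maps_def continuous_map_in_subtopology)
  have "continuous_map (top_of_set (\<phi> ` U)) X g"
    using g by (auto simp: homeomorphic_maps_def continuous_map_in_subtopology)
  moreover have "g y = inv_into U \<phi> y" if "y \<in> \<phi> ` U" for y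
  proof -
    obtain x where "x \<in> U" "y = \<phi> x" using \<open>y \<in> \<phi> ` U\<close> by blast
    then show ?thesis using g inj sub by (auto simp: homeomorphic_maps_def)
  qed
  ultimately show "continuous_map (top_of_set (\<phi> ` U)) X (inv_into U \<phi>)"
    by (rule continuous_map_eq) simp
qed

lemma chart_image_openin:
  assumes "(U, \<phi>) \<in> A" "openin X V" "V \<subseteq> U"
  shows "open (\<phi> ` V)"
proof -
  have "openin (subtopology X U) V" using assms(2,3) openin_subset_topspace_eq by (metis inf.absorb_iff2 openin_subtopology_Int2)
  then have "openin (top_of_set (\<phi> ` U)) (\<phi> ` V)"
    using homeomorphic_imp_open_map[OF chart_homeomorphic[OF assms(1)]] by (simp add: open_map_def)
  then show ?thesis using chart_image[OF assms(1)] openin_open_eq by blast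
qed

lemma transition_has_derivative:
  assumes "(U, \<phi>) \<in> A" "(V, \<psi>) \<in> A" "p \<in> U \<inter> V"
  shows "(transition (U, \<phi>) (V, \<psi>) has_derivative
           frechet_derivative (transition (U, \<phi>) (V, \<psi>)) (at (\<phi> p))) (at (\<phi> p))"
proof -
  have "open (\<phi> ` (U \<inter> V))"
    using assms chart_domain by (intro chart_image_openin[of U]) (auto intro: openin_Int)
  moreover have "transition (U, \<phi>) (V, \<psi>) differentiable_on \<phi> ` (U \<inter> V)"
    using charts_compatible[OF assms(1,2), unfolded smooth_on_def, rule_format, of 1] by simp
  ultimately show ?thesis
    using assms(3) frechet_derivative_works
    by (metis differentiable_on_def at_within_open imageI)
qed

lemma preimage_openin:
  assumes "continuous_map (top_of_set S) X \<alpha>" "openin X U"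
  shows "openin (top_of_set S) {t \<in> S. \<alpha> t \<in> U}"
  using openin_continuous_map_preimage[OF assms] by simp

text \<open>
  Continuity is part of a piece, so that a piecewise smooth curve is nothing but a chain of pieces.
  For the height component of a cylinder curve it follows from smoothness.
\<close>

definition base_piece :: "(real \<Rightarrow> 'a) \<Rightarrow> real \<Rightarrow> real \<Rightarrow> bool" where
  "base_piece \<alpha> a b \<longleftrightarrow> continuous_map (top_of_set {a..b}) X \<alpha> \<and> smooth_curve_on A a b \<alpha>"

definition cylinder_piece :: "real set \<Rightarrow> (real \<Rightarrow> real \<times> 'a) \<Rightarrow> real \<Rightarrow> real \<Rightarrow> bool" where
  "cylinder_piece T \<gamma> a b \<longleftrightarrow>
     smooth_on {a..b} (fst \<circ> \<gamma>) \<and> (fst \<circ> \<gamma>) ` {a..b} \<subseteq> T \<and> base_piece (snd \<circ> \<gamma>) a b"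

lemma chart_on_piece:
  assumes "a < b" "base_piece \<alpha> a b" "(U, \<phi>) \<in> A"
  defines "R \<equiv> {t \<in> {a..b}. \<alpha> t \<in> U}"
  shows "openin (top_of_set {a..b}) R"
    and "\<And>t. t \<in> R \<Longrightarrow> at t within R = at t within {a..b}"
    and "\<And>t. t \<in> R \<Longrightarrow> ((\<phi> \<circ> \<alpha>) has_vector_derivative vector_derivative (\<phi> \<circ> \<alpha>) (at t within {a..b}))
                          (at t within {a..b})"
    and "continuous_on R (\<lambda>t. vector_derivative (\<phi> \<circ> \<alpha>) (at t within {a..b}))"
    and "continuous_on R (\<phi> \<circ> \<alpha>)"
proof -
  show R: "openin (top_of_set {a..b}) R"
    unfolding R_def using assms chart_domain by (intro preimage_openin) (auto simp: base_piece_def)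
  show eq: "at t within R = at t within {a..b}" if "t \<in> R" for t
    using at_within_relatively_open_nontrivial(1)[OF \<open>a < b\<close> R that] .
  have nontriv: "at t within R \<noteq> bot" if "t \<in> R" for t
    using at_within_relatively_open_nontrivial(2)[OF \<open>a < b\<close> R that] .
  have smooth: "smooth_on R (\<phi> \<circ> \<alpha>)"
    using assms by (auto simp: base_piece_def smooth_curve_on_def)
  show "((\<phi> \<circ> \<alpha>) has_vector_derivative vector_derivative (\<phi> \<circ> \<alpha>) (at t within {a..b}))
      (at t within {a..b})" if "t \<in> R" for t
    using smooth_on_imp_C1(1)[OF smooth nontriv that] eq[OF that] by simp
  show "continuous_on R (\<lambda>t. vector_derivative (\<phi> \<circ> \<alpha>) (at t within {a..b}))"
    using smooth_on_imp_C1(2)[OF smooth nontriv] eq by (simp cong: continuous_on_cong)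
  show "continuous_on R (\<phi> \<circ> \<alpha>)"
    using smooth[unfolded smooth_on_def, rule_format, of 0] by simp
qed

definition chart_at :: "'a \<Rightarrow> ('a, 'b) chart" where
  "chart_at p = (SOME c. c \<in> A \<and> p \<in> fst c)"

lemma chart_at:
  assumes "p \<in> topspace X"
  shows "chart_at p \<in> A" "p \<in> fst (chart_at p)"
proof -
  have "\<exists>c. c \<in> A \<and> p \<in> fst c" using assms charts_cover by blast
  then have "chart_at p \<in> A \<and> p \<in> fst (chart_at p)" unfolding chart_at_def by (rule someI_ex)
  then show "chart_at p \<in> A" "p \<in> fst (chart_at p)" by auto
qed

lemma base_piece_in_space: "base_piece \<alpha> a b \<Longrightarrow> t \<in> {a..b} \<Longrightarrow> \<alpha> t \<in> topspace X"
  using continuous_map_image_subset_topspace[of "top_of_set {a..b}" X \<alpha>]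
  by (auto simp: base_piece_def)

end

context riemannian_manifold
begin

lemma metric_nonneg:
  assumes "(U, \<phi>) \<in> A" "p \<in> U"
  shows "0 \<le> \<sigma> (U, \<phi>) p v v"
  using metric_pos[OF assms, of v] bilinear_lzero[OF metric_bilinear[OF assms]]
  by (cases "v = 0") (auto intro: less_imp_le)

text \<open>
  The set \<open>S\<close> within which the curve is differentiated is a parameter. On a closed piece it is the
  interval of the piece, which makes the speed continuous up to the endpoints. At interior parameters
  it may be taken to be \<open>UNIV\<close>, which makes the speed independent of the surrounding interval.
\<close>

definition chart_speed_sq :: "('a, 'b) chart \<Rightarrow> (real \<Rightarrow> 'a) \<Rightarrow> real set \<Rightarrow> real \<Rightarrow> real" where
  "chart_speed_sq c \<alpha> S t =
     (let v = vector_derivative (snd c \<circ> \<alpha>) (at t within S) in \<sigma> c (\<alpha> t) v v)"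

definition speed_sq_within :: "(real \<Rightarrow> 'a) \<Rightarrow> real set \<Rightarrow> real \<Rightarrow> real" where
  "speed_sq_within \<alpha> S t = chart_speed_sq (chart_at (\<alpha> t)) \<alpha> S t"

lemma speed_sq_eq: "speed_sq A \<sigma> \<alpha> t = speed_sq_within \<alpha> {0..1} t"
  by (simp add: speed_sq_def speed_sq_within_def chart_speed_sq_def chart_at_def Let_def)

text \<open>
  By the chain rule, the derivative of the transition map carries one coordinate velocity to the
  other; the transformation law of the metric says exactly that this preserves the speed.
\<close>

lemma chart_speed_sq_independent:
  assumes ab: "a < b" "base_piece \<alpha> a b" "t \<in> {a..b}"
    and UV: "(U, \<phi>) \<in> A" "(V, \<psi>) \<in> A" "\<alpha> t \<in> U" "\<alpha> t \<in> V"
  shows "chart_speed_sq (U, \<phi>) \<alpha> {a..b} t = chart_speed_sq (V, \<psi>) \<alpha> {a..b} t"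
proof -
  let ?T = "transition (U, \<phi>) (V, \<psi>)"
  let ?D = "frechet_derivative ?T (at (\<phi> (\<alpha> t)))"
  let ?v = "vector_derivative (\<phi> \<circ> \<alpha>) (at t within {a..b})"
  define R where "R = {s \<in> {a..b}. \<alpha> s \<in> U}"
  note R = chart_on_piece[OF ab(1,2) UV(1), folded R_def]
  have t: "t \<in> R" using ab UV by (auto simp: R_def)
  have nontriv: "at t within {a..b} \<noteq> bot"
    using at_within_relatively_open_nontrivial[OF ab(1) R(1) t] by simp
  have "(?T has_derivative ?D) (at ((\<phi> \<circ> \<alpha>) t) within (\<phi> \<circ> \<alpha>) ` {a..b})"
    using transition_has_derivative[OF UV(1,2)] UV(3,4) by (auto intro: has_derivative_at_withinI)
  then have "(?T \<circ> (\<phi> \<circ> \<alpha>) has_vector_derivative ?D ?v) (at t within {a..b})"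
    using R(3)[OF t] by (rule vector_derivative_diff_chain_within[rotated])
  then have "(?T \<circ> (\<phi> \<circ> \<alpha>) has_vector_derivative ?D ?v) (at t within R)"
    using R(2)[OF t] by simp
  then have "(\<psi> \<circ> \<alpha> has_vector_derivative ?D ?v) (at t within R)"
  proof (rule has_vector_derivative_transform[OF t, rotated])
    show "(\<psi> \<circ> \<alpha>) s = (?T \<circ> (\<phi> \<circ> \<alpha>)) s" if "s \<in> R" for s
      using that chart_inj[OF UV(1)] by (simp add: R_def transition_def)
  qed
  then have "vector_derivative (\<psi> \<circ> \<alpha>) (at t within {a..b}) = ?D ?v"
    using vector_derivative_within[OF nontriv] R(2)[OF t] by simp
  moreover have "\<sigma> (U, \<phi>) (\<alpha> t) ?v ?v = \<sigma> (V, \<psi>) (\<alpha> t) (?D ?v) (?D ?v)"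
    using metric_transform[OF UV(1,2)] UV(3,4) by blast
  ultimately show ?thesis by (simp add: chart_speed_sq_def Let_def)
qed

lemma speed_sq_within_in_chart:
  assumes "a < b" "base_piece \<alpha> a b" "t \<in> {a..b}" "c \<in> A" "\<alpha> t \<in> fst c"
  shows "speed_sq_within \<alpha> {a..b} t = chart_speed_sq c \<alpha> {a..b} t"
proof -
  have "\<alpha> t \<in> topspace X" using base_piece_in_space assms(2,3) by blast
  note c = chart_at[OF this]
  show ?thesis unfolding speed_sq_within_def
    using chart_speed_sq_independent[OF assms(1-3), of "fst (chart_at (\<alpha> t))" "snd (chart_at (\<alpha> t))" "fst c" "snd c"]
      c assms(4,5) by simp
qed

lemma speed_sq_within_nonneg: "\<alpha> t \<in> topspace X \<Longrightarrow> 0 \<le> speed_sq_within \<alpha> S t"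
  using chart_at[of "\<alpha> t"] metric_nonneg[of "fst (chart_at (\<alpha> t))" "snd (chart_at (\<alpha> t))" "\<alpha> t"]
  by (simp add: speed_sq_within_def chart_speed_sq_def Let_def)

text \<open>
  Smoothness of the metric is given for fixed vectors only; expanding in a basis yields joint
  continuity.
\<close>

lemma metric_continuous:
  assumes c: "(U, \<phi>) \<in> A" and g: "continuous_on R g" "g ` R \<subseteq> \<phi> ` U" and v: "continuous_on R v"
  shows "continuous_on R (\<lambda>t. \<sigma> (U, \<phi>) (inv_into U \<phi> (g t)) (v t) (v t))"
proof -
  obtain E where E: "finite E" "\<And>v::'b. v = (\<Sum>e\<in>E. (v \<bullet> e) *\<^sub>R e)"
    using orthonormal_basis_exists finite_dim by metis
  have "inv_into U \<phi> (g t) \<in> U" if "t \<in> R" for t using g(2) that inv_into_into[of "g t" \<phi> U] by blast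
  then have "\<sigma> (U, \<phi>) (inv_into U \<phi> (g t)) (v t) (v t) =
      (\<Sum>(d, e)\<in>E\<times>E. (v t \<bullet> d) * (v t \<bullet> e) * \<sigma> (U, \<phi>) (inv_into U \<phi> (g t)) d e)" if "t \<in> R" for t
    using bilinear_expand[OF metric_bilinear[OF c] E(2)] that by blast
  moreover have "continuous_on R (\<lambda>t. \<sigma> (U, \<phi>) (inv_into U \<phi> (g t)) d e)" for d e
    using metric_smooth[OF c, unfolded smooth_on_def, rule_format, of 0] g
    by (auto intro: continuous_on_compose2[of "\<phi> ` U"])
  then have "continuous_on R (\<lambda>t. \<Sum>(d, e)\<in>E\<times>E. (v t \<bullet> d) * (v t \<bullet> e) * \<sigma> (U, \<phi>) (inv_into U \<phi> (g t)) d e)"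
    unfolding case_prod_unfold by (intro continuous_intros v)
  ultimately show ?thesis by (simp cong: continuous_on_cong)
qed

text \<open>
  The chart that is chosen at each parameter varies without any continuity, but by independence it
  may be replaced by one chart near a given parameter.
\<close>

lemma speed_sq_within_continuous:
  assumes ab: "a < b" "base_piece \<alpha> a b"
  shows "continuous_on {a..b} (speed_sq_within \<alpha> {a..b})"
  unfolding continuous_on_eq_continuous_within
proof
  fix t assume t: "t \<in> {a..b}"
  then have "\<alpha> t \<in> topspace X" using base_piece_in_space ab by blast
  then obtain U \<phi> where c: "(U, \<phi>) \<in> A" "\<alpha> t \<in> U" using charts_cover by fastforce
  define R where "R = {s \<in> {a..b}. \<alpha> s \<in> U}"
  note R = chart_on_piece[OF ab c(1), folded R_def]
  have "continuous_on R (\<lambda>s. \<sigma> (U, \<phi>) (inv_into U \<phi> ((\<phi> \<circ> \<alpha>) s))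
      (vector_derivative (\<phi> \<circ> \<alpha>) (at s within {a..b})) (vector_derivative (\<phi> \<circ> \<alpha>) (at s within {a..b})))"
    by (rule metric_continuous[OF c(1) R(5) _ R(4)]) (auto simp: R_def)
  moreover have "\<sigma> (U, \<phi>) (inv_into U \<phi> ((\<phi> \<circ> \<alpha>) s))
      (vector_derivative (\<phi> \<circ> \<alpha>) (at s within {a..b})) (vector_derivative (\<phi> \<circ> \<alpha>) (at s within {a..b})) =
      speed_sq_within \<alpha> {a..b} s" if "s \<in> R" for s
    using speed_sq_within_in_chart[OF ab, of s "(U, \<phi>)"] that c chart_inj[OF c(1)]
    by (auto simp: R_def chart_speed_sq_def Let_def)
  ultimately have "continuous_on R (speed_sq_within \<alpha> {a..b})" by (simp cong: continuous_on_cong)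
  moreover have "t \<in> R" using t c by (simp add: R_def)
  ultimately show "continuous (at t within {a..b}) (speed_sq_within \<alpha> {a..b})"
    using R(2) by (auto simp: continuous_on_eq_continuous_within)
qed

definition warped_speed :: "(real \<Rightarrow> real) \<Rightarrow> (real \<Rightarrow> real \<times> 'a) \<Rightarrow> real set \<Rightarrow> real \<Rightarrow> real" where
  "warped_speed f \<gamma> S t = sqrt ((vector_derivative (fst \<circ> \<gamma>) (at t within S))\<^sup>2 +
     (f (fst (\<gamma> t)))\<^sup>2 * speed_sq_within (snd \<circ> \<gamma>) S t)"

lemma speed_sq_within_interior:
  "a < t \<Longrightarrow> t < b \<Longrightarrow> speed_sq_within \<alpha> {a..b} t = speed_sq_within \<alpha> UNIV t"
  by (simp add: speed_sq_within_def chart_speed_sq_def at_within_Icc_at)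

lemma warped_speed_interior:
  "a < t \<Longrightarrow> t < b \<Longrightarrow> warped_speed f \<gamma> {a..b} t = warped_speed f \<gamma> UNIV t"
  by (simp add: warped_speed_def speed_sq_within_interior at_within_Icc_at)

text \<open>
  At the two endpoints of the unit interval the one-sided derivatives of the definition differ from
  the two-sided ones, which does not affect the integral.
\<close>

lemma warped_length_eq: "warped_length A \<sigma> f \<gamma> = integral {0..1} (warped_speed f \<gamma> UNIV)"
proof -
  have "warped_length A \<sigma> f \<gamma> = integral {0..1} (warped_speed f \<gamma> {0..1})"
    by (simp add: warped_length_def warped_speed_def[abs_def] speed_sq_eq)
  also have "\<dots> = integral {0..1} (warped_speed f \<gamma> UNIV)"
    by (rule integral_spike[of "{0, 1}"]) (auto simp: warped_speed_interior)
  finally show ?thesis .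
qed

lemma riem_length_eq:
  "integral {0..1} (\<lambda>t. sqrt (speed_sq A \<sigma> \<alpha> t)) = integral {0..1} (\<lambda>t. sqrt (speed_sq_within \<alpha> UNIV t))"
  unfolding speed_sq_eq by (rule integral_spike[of "{0, 1}"]) (auto simp: speed_sq_within_interior)

lemma smooth_real_continuous_derivative:
  assumes "a < b" "smooth_on {a..b} (g :: real \<Rightarrow> real)"
  shows "continuous_on {a..b} g"
    and "continuous_on {a..b} (\<lambda>t. vector_derivative g (at t within {a..b}))"
    and "\<And>t. t \<in> {a..b} \<Longrightarrow>
      (g has_vector_derivative vector_derivative g (at t within {a..b})) (at t within {a..b})"
proof -
  show "continuous_on {a..b} g" using assms(2)[unfolded smooth_on_def, rule_format, of 0] by simp
  have "at t within {a..b} \<noteq> bot" if "t \<in> {a..b}" for t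
    using at_within_relatively_open_nontrivial(2)[OF assms(1) openin_subtopology_self that] .
  note C1 = smooth_on_imp_C1[OF assms(2) this]
  show "continuous_on {a..b} (\<lambda>t. vector_derivative g (at t within {a..b}))" using C1(2) .
  show "\<And>t. t \<in> {a..b} \<Longrightarrow>
      (g has_vector_derivative vector_derivative g (at t within {a..b})) (at t within {a..b})" using C1(1) .
qed

text \<open>
  The function \<open>f\<close> is only measurable, so the integrand is measurable as well, and it is dominated by the
  continuous function that has the bound \<open>K\<close> in place of \<open>f\<close>.
\<close>

lemma warped_speed_integrable_on_piece:
  assumes ab: "a < b" "cylinder_piece T \<gamma> a b"
    and f: "f \<in> borel_measurable (restrict_space borel T)" "\<And>x. x \<in> T \<Longrightarrow> \<bar>f x\<bar> \<le> K"
  shows "warped_speed f \<gamma> UNIV integrable_on {a..b}"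
proof -
  let ?d = "\<lambda>t. vector_derivative (fst \<circ> \<gamma>) (at t within {a..b})"
  let ?s = "speed_sq_within (snd \<circ> \<gamma>) {a..b}"
  have g: "smooth_on {a..b} (fst \<circ> \<gamma>)" "(fst \<circ> \<gamma>) ` {a..b} \<subseteq> T" "base_piece (snd \<circ> \<gamma>) a b"
    using ab by (auto simp: cylinder_piece_def)
  note d = smooth_real_continuous_derivative[OF ab(1) g(1)]
  note s = speed_sq_within_continuous[OF ab(1) g(3)]
  have s0: "0 \<le> ?s t" if "t \<in> {a..b}" for t
    using base_piece_in_space[OF g(3) that] by (rule speed_sq_within_nonneg)
  have "(fst \<circ> \<gamma>) \<in> measurable (lebesgue_on {a..b}) (restrict_space borel T)"
    using g(2) d(1) by (intro measurable_restrict_space2 continuous_imp_measurable_on_sets_lebesgue) auto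
  from measurable_comp[OF this f(1)]
  have "(\<lambda>t. f (fst (\<gamma> t))) \<in> borel_measurable (lebesgue_on {a..b})" by (simp add: o_def)
  moreover have "?d \<in> borel_measurable (lebesgue_on {a..b})" "?s \<in> borel_measurable (lebesgue_on {a..b})"
    using d(2) s by (auto intro: continuous_imp_measurable_on_sets_lebesgue)
  ultimately have meas: "warped_speed f \<gamma> {a..b} \<in> borel_measurable (lebesgue_on {a..b})"
    unfolding warped_speed_def by measurable
  have "warped_speed f \<gamma> {a..b} integrable_on {a..b}"
  proof (rule measurable_bounded_by_integrable_imp_integrable_real[OF meas])
    show "(\<lambda>t. sqrt ((?d t)\<^sup>2 + K\<^sup>2 * ?s t)) integrable_on {a..b}"
      by (intro integrable_continuous_real continuous_intros d s)
    show "\<bar>warped_speed f \<gamma> {a..b} t\<bar> \<le> sqrt ((?d t)\<^sup>2 + K\<^sup>2 * ?s t)" if t: "t \<in> {a..b}" for t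
    proof -
      have "(f (fst (\<gamma> t)))\<^sup>2 \<le> K\<^sup>2"
        using f(2)[of "fst (\<gamma> t)"] g(2) t abs_le_square_iff[of "f (fst (\<gamma> t))" K] by fastforce
      then show ?thesis using s0[OF t] by (simp add: warped_speed_def mult_right_mono)
    qed
  qed simp
  then show ?thesis
    by (rule integrable_spike_finite[of "{a, b}", rotated 2]) (auto simp: warped_speed_interior)
qed

lemma warped_speed_integrable:
  assumes "chain (cylinder_piece T \<gamma>) a b"
    and f: "f \<in> borel_measurable (restrict_space borel T)" "\<And>x. x \<in> T \<Longrightarrow> \<bar>f x\<bar> \<le> K"
  shows "warped_speed f \<gamma> UNIV integrable_on {a..b}"
  using assms(1)
proof (induction rule: chain.induct)
  case (piece a b)
  then show ?case using warped_speed_integrable_on_piece f by blast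
next
  case (join a b c)
  then show ?case using chain_less[OF join(1)] chain_less[OF join(2)]
    by (intro Henstock_Kurzweil_Integration.integrable_combine[of a b c]) auto
qed

end

section \<open>Operations on curves\<close>

context riemannian_manifold
begin

lemma base_chain_continuous:
  assumes "chain (base_piece \<alpha>) a b"
  shows "continuous_map (top_of_set {a..b}) X \<alpha>"
  using assms
proof (induction rule: chain.induct)
  case (join a b c)
  then have abc: "a < b" "b < c" using chain_less by blast+
  have "continuous_map (top_of_set {a..c}) X (\<lambda>t. if t \<le> b then \<alpha> t else \<alpha> t)"
  proof (rule continuous_map_cases_le)
    show "continuous_map (top_of_set {a..c}) euclideanreal (\<lambda>t. t)"
      "continuous_map (top_of_set {a..c}) euclideanreal (\<lambda>t. b)" by auto
    have eqs: "{a..c} \<inter> {t \<in> {a..c}. t \<le> b} = {a..b}" "{a..c} \<inter> {t \<in> {a..c}. b \<le> t} = {b..c}"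
      using abc by auto
    show "continuous_map (subtopology (top_of_set {a..c}) {t \<in> topspace (top_of_set {a..c}). t \<le> b}) X \<alpha>"
      "continuous_map (subtopology (top_of_set {a..c}) {t \<in> topspace (top_of_set {a..c}). b \<le> t}) X \<alpha>"
      using join.IH by (simp_all only: subtopology_subtopology topspace_euclidean_subtopology eqs)
  qed simp
  then show ?case by simp
qed (simp add: base_piece_def)

lemma piecewise_smooth_curve_iff_chain:
  "piecewise_smooth_curve X A \<alpha> \<longleftrightarrow> chain (base_piece \<alpha>) 0 1"
proof
  assume \<alpha>: "piecewise_smooth_curve X A \<alpha>"
  then have "chain (\<lambda>a b. smooth_curve_on A a b \<alpha>) 0 1"
    by (simp add: piecewise_smooth_curve_def chain_iff_partition)
  then show "chain (base_piece \<alpha>) 0 1"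
  proof (rule chain_mono)
    fix a b :: real assume "0 \<le> a" "b \<le> 1" "smooth_curve_on A a b \<alpha>"
    moreover have "continuous_map (top_of_set {0..1}) X \<alpha>" using \<alpha> by (simp add: piecewise_smooth_curve_def)
    ultimately show "base_piece \<alpha> a b"
      unfolding base_piece_def using continuous_map_from_subtopology_mono by fastforce
  qed
next
  assume \<alpha>: "chain (base_piece \<alpha>) 0 1"
  then have "chain (\<lambda>a b. smooth_curve_on A a b \<alpha>) 0 1"
    by (rule chain_mono) (simp add: base_piece_def)
  then show "piecewise_smooth_curve X A \<alpha>"
    using base_chain_continuous[OF \<alpha>] by (simp add: piecewise_smooth_curve_def chain_iff_partition)
qed

lemma cylinder_chain_base:
  "chain (cylinder_piece T \<gamma>) a b \<Longrightarrow> chain (base_piece (snd \<circ> \<gamma>)) a b"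
  by (erule chain_mono) (simp add: cylinder_piece_def)

lemma cylinder_chain_height:
  assumes "chain (cylinder_piece T \<gamma>) a b"
  shows "continuous_on {a..b} (fst \<circ> \<gamma>) \<and> (fst \<circ> \<gamma>) ` {a..b} \<subseteq> T"
  using assms
proof (induction rule: chain.induct)
  case (piece a b)
  then show ?case
    using smooth_real_continuous_derivative(1)[OF piece(1), of "fst \<circ> \<gamma>"] by (simp add: cylinder_piece_def)
next
  case (join a b c)
  then have abc: "{a..c} = {a..b} \<union> {b..c}" using chain_less[OF join(1)] chain_less[OF join(2)] by auto
  show ?case unfolding abc using join.IH by (auto intro!: continuous_on_closed_Un)
qed

lemma piecewise_smooth_cylinder_curve_iff_chain:
  "piecewise_smooth_cylinder_curve t0 t1 X A \<gamma> \<longleftrightarrow> chain (cylinder_piece {t0..t1} \<gamma>) 0 1"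
proof
  assume \<gamma>: "piecewise_smooth_cylinder_curve t0 t1 X A \<gamma>"
  then have "chain (\<lambda>a b. smooth_on {a..b} (fst \<circ> \<gamma>) \<and> smooth_curve_on A a b (snd \<circ> \<gamma>)) 0 1"
    by (simp add: piecewise_smooth_cylinder_curve_def chain_iff_partition)
  then show "chain (cylinder_piece {t0..t1} \<gamma>) 0 1"
  proof (rule chain_mono)
    fix a b :: real
    assume ab: "0 \<le> a" "b \<le> 1" "smooth_on {a..b} (fst \<circ> \<gamma>) \<and> smooth_curve_on A a b (snd \<circ> \<gamma>)"
    have "continuous_map (top_of_set {0..1}) (prod_topology (top_of_set {t0..t1}) X) \<gamma>"
      using \<gamma> by (simp add: piecewise_smooth_cylinder_curve_def)
    then have "continuous_map (top_of_set {0..1}) (top_of_set {t0..t1}) (fst \<circ> \<gamma>)"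
      and 2: "continuous_map (top_of_set {0..1}) X (snd \<circ> \<gamma>)"
      by (simp_all add: continuous_map_pairwise)
    then have "(fst \<circ> \<gamma>) ` {0..1} \<subseteq> {t0..t1}"
      using continuous_map_image_subset_topspace by fastforce
    then have "(fst \<circ> \<gamma>) ` {a..b} \<subseteq> {t0..t1}" using ab(1,2) by (force simp: image_subset_iff)
    moreover have "continuous_map (top_of_set {a..b}) X (snd \<circ> \<gamma>)"
      using 2 by (rule continuous_map_from_subtopology_mono) (use ab in auto)
    ultimately show "cylinder_piece {t0..t1} \<gamma> a b"
      unfolding cylinder_piece_def base_piece_def using ab by blast
  qed
next
  assume \<gamma>: "chain (cylinder_piece {t0..t1} \<gamma>) 0 1"
  then have "chain (\<lambda>a b. smooth_on {a..b} (fst \<circ> \<gamma>) \<and> smooth_curve_on A a b (snd \<circ> \<gamma>)) 0 1"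
    by (rule chain_mono) (simp add: cylinder_piece_def base_piece_def)
  moreover have "continuous_map (top_of_set {0..1}) (prod_topology (top_of_set {t0..t1}) X) \<gamma>"
    using base_chain_continuous[OF cylinder_chain_base[OF \<gamma>]] cylinder_chain_height[OF \<gamma>]
    by (auto simp: continuous_map_pairwise continuous_map_in_subtopology)
  ultimately show "piecewise_smooth_cylinder_curve t0 t1 X A \<gamma>"
    by (simp add: piecewise_smooth_cylinder_curve_def chain_iff_partition)
qed

lemma smooth_curve_on_cong:
  assumes "\<And>t. t \<in> {a..b} \<Longrightarrow> \<alpha> t = \<beta> t"
  shows "smooth_curve_on A a b \<alpha> \<longleftrightarrow> smooth_curve_on A a b \<beta>"
proof -
  have "smooth_on {t \<in> {a..b}. \<alpha> t \<in> U} (\<phi> \<circ> \<alpha>) \<longleftrightarrow> smooth_on {t \<in> {a..b}. \<beta> t \<in> U} (\<phi> \<circ> \<beta>)" for U and \<phi> :: "'a \<Rightarrow> 'b"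
  proof -
    have "{t \<in> {a..b}. \<alpha> t \<in> U} = {t \<in> {a..b}. \<beta> t \<in> U}" using assms by auto
    then show ?thesis using assms smooth_on_cong[of "{t \<in> {a..b}. \<beta> t \<in> U}" "\<phi> \<circ> \<alpha>" "\<phi> \<circ> \<beta>"] by simp
  qed
  then show ?thesis by (simp add: smooth_curve_on_def case_prod_unfold del: atLeastAtMost_iff)
qed

lemma base_piece_cong:
  assumes "\<And>t. t \<in> {a..b} \<Longrightarrow> \<alpha> t = \<beta> t"
  shows "base_piece \<alpha> a b \<longleftrightarrow> base_piece \<beta> a b"
proof -
  have "continuous_map (top_of_set {a..b}) X \<alpha> \<longleftrightarrow> continuous_map (top_of_set {a..b}) X \<beta>"
    using assms by (auto intro: continuous_map_eq)
  then show ?thesis using smooth_curve_on_cong[OF assms] by (simp add: base_piece_def)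
qed

lemma cylinder_piece_cong:
  assumes "\<And>t. t \<in> {a..b} \<Longrightarrow> \<gamma> t = \<eta> t"
  shows "cylinder_piece T \<gamma> a b \<longleftrightarrow> cylinder_piece T \<eta> a b"
  using assms smooth_on_cong[of "{a..b}" "fst \<circ> \<gamma>" "fst \<circ> \<eta>"] base_piece_cong[of a b "snd \<circ> \<gamma>" "snd \<circ> \<eta>"]
  by (auto simp: cylinder_piece_def)

lemma base_piece_affine:
  assumes "a < b" "base_piece \<alpha> c d" "(\<lambda>t. k + t * m) ` {a..b} \<subseteq> {c..d}"
  shows "base_piece (\<lambda>t. \<alpha> (k + t * m)) a b"
proof -
  have cont: "continuous_map (top_of_set {a..b}) X (\<lambda>t. \<alpha> (k + t * m))"
  proof -
    have "continuous_on {a..b} (\<lambda>t. k + t * m)" by (intro continuous_intros)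
    then have line: "continuous_map (top_of_set {a..b}) (top_of_set {c..d}) (\<lambda>t. k + t * m)"
      using assms(3) by (simp add: continuous_map_in_subtopology image_subset_iff_funcset)
    show ?thesis
      using continuous_map_compose[OF line, of X \<alpha>] assms(2) by (simp add: base_piece_def o_def)
  qed
  have "smooth_on {t \<in> {a..b}. \<alpha> (k + t * m) \<in> U} (\<phi> \<circ> (\<lambda>t. \<alpha> (k + t * m)))" if c: "(U, \<phi>) \<in> A" for U \<phi>
  proof -
    let ?R = "{t \<in> {a..b}. \<alpha> (k + t * m) \<in> U}"
    have "at t within ?R \<noteq> bot" if "t \<in> ?R" for t
      using at_within_relatively_open_nontrivial(2)[OF assms(1) preimage_openin[OF cont chart_domain[OF c]] that] .
    moreover have "smooth_on {t \<in> {c..d}. \<alpha> t \<in> U} (\<phi> \<circ> \<alpha>)"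
      using assms(2) c by (auto simp: base_piece_def smooth_curve_on_def)
    moreover have "(\<lambda>t. k + t *\<^sub>R m) ` ?R \<subseteq> {t \<in> {c..d}. \<alpha> t \<in> U}"
      using assms(3) by (auto simp del: atLeastAtMost_iff)
    ultimately have "smooth_on ?R (\<lambda>t. (\<phi> \<circ> \<alpha>) (k + t *\<^sub>R m))"
      using smooth_on_along_line[of "{t \<in> {c..d}. \<alpha> t \<in> U}" "\<phi> \<circ> \<alpha>" k m ?R] by blast
    then show ?thesis by (simp add: o_def)
  qed
  then show ?thesis using cont by (auto simp: base_piece_def smooth_curve_on_def)
qed

text \<open>
  As \<open>m\<close> may have either sign and the image of \<open>[a, b]\<close> need not be all of \<open>[c, d]\<close>, this covers
  reversal, rescaling and restriction of a piece.
\<close>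

lemma cylinder_piece_affine:
  assumes "a < b" "cylinder_piece T \<gamma> c d" "(\<lambda>t. k + t * m) ` {a..b} \<subseteq> {c..d}"
  shows "cylinder_piece T (\<lambda>t. \<gamma> (k + t * m)) a b"
proof -
  have g: "smooth_on {c..d} (fst \<circ> \<gamma>)" "(fst \<circ> \<gamma>) ` {c..d} \<subseteq> T" "base_piece (snd \<circ> \<gamma>) c d"
    using assms(2) by (auto simp: cylinder_piece_def)
  have "at t within {a..b} \<noteq> bot" if "t \<in> {a..b}" for t
    using at_within_relatively_open_nontrivial(2)[OF assms(1) openin_subtopology_self that] .
  then have "smooth_on {a..b} (\<lambda>t. (fst \<circ> \<gamma>) (k + t *\<^sub>R m))"
    using assms(3) by (intro smooth_on_along_line[OF g(1)]) auto
  moreover have "(\<lambda>t. (fst \<circ> \<gamma>) (k + t * m)) ` {a..b} \<subseteq> T" using g(2) assms(3) by fastforce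
  moreover have "base_piece (\<lambda>t. (snd \<circ> \<gamma>) (k + t * m)) a b" by (rule base_piece_affine[OF assms(1) g(3) assms(3)])
  ultimately show ?thesis by (simp add: cylinder_piece_def o_def)
qed

text \<open>
  The chain rule and the fundamental theorem of calculus are applied away from the finitely many
  subdivision points. The condition collects what holds at all other parameters.
\<close>

definition regular_at :: "(real \<Rightarrow> real \<times> 'a) \<Rightarrow> real \<Rightarrow> bool" where
  "regular_at \<gamma> t \<longleftrightarrow> snd (\<gamma> t) \<in> topspace X \<and> (fst \<circ> \<gamma>) differentiable (at t) \<and>
     (\<forall>c\<in>A. snd (\<gamma> t) \<in> fst c \<longrightarrow> (snd c \<circ> (snd \<circ> \<gamma>)) differentiable (at t) \<and>
        speed_sq_within (snd \<circ> \<gamma>) UNIV t = chart_speed_sq c (snd \<circ> \<gamma>) UNIV t)"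

lemma cylinder_chain_regular:
  assumes "chain (cylinder_piece T \<gamma>) a b"
  shows "\<exists>S. finite S \<and> (\<forall>t\<in>{a..b} - S. regular_at \<gamma> t)"
  using assms
proof (induction rule: chain.induct)
  case (piece a b)
  have g: "smooth_on {a..b} (fst \<circ> \<gamma>)" "base_piece (snd \<circ> \<gamma>) a b"
    using piece by (auto simp: cylinder_piece_def)
  have "regular_at \<gamma> t" if t: "a < t" "t < b" for t
  proof -
    have "(fst \<circ> \<gamma>) differentiable (at t)"
      using smooth_real_continuous_derivative(3)[OF piece(1) g(1), of t] t
      by (auto simp: at_within_Icc_at intro: differentiableI_vector)
    moreover have "(snd c \<circ> (snd \<circ> \<gamma>)) differentiable (at t)" if "c \<in> A" "snd (\<gamma> t) \<in> fst c" for c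
      using chart_on_piece(3)[OF piece(1) g(2), of "fst c" "snd c" t] t that
      by (auto simp: at_within_Icc_at intro: differentiableI_vector)
    moreover have "speed_sq_within (snd \<circ> \<gamma>) UNIV t = chart_speed_sq c (snd \<circ> \<gamma>) UNIV t"
      if "c \<in> A" "snd (\<gamma> t) \<in> fst c" for c
      using speed_sq_within_in_chart[OF piece(1) g(2), of t c] t that
      by (simp add: speed_sq_within_interior chart_speed_sq_def at_within_Icc_at)
    moreover have "snd (\<gamma> t) \<in> topspace X" using base_piece_in_space[OF g(2), of t] t by simp
    ultimately show ?thesis by (simp add: regular_at_def)
  qed
  then show ?case by (intro exI[of _ "{a, b}"]) auto
next
  case (join a b c)
  then obtain S S' where "finite S" "\<forall>t\<in>{a..b} - S. regular_at \<gamma> t" "finite S'" "\<forall>t\<in>{b..c} - S'. regular_at \<gamma> t"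
    by blast
  moreover have "{a..c} \<subseteq> {a..b} \<union> {b..c}" by auto
  ultimately show ?case by (intro exI[of _ "S \<union> S'"]) blast
qed

lemma warped_speed_affine:
  assumes "regular_at \<gamma> (k + t * m)"
  shows "warped_speed f (\<lambda>t. \<gamma> (k + t * m)) UNIV t = \<bar>m\<bar> * warped_speed f \<gamma> UNIV (k + t * m)"
proof -
  let ?a = "\<lambda>t. k + t * m" and ?p = "snd (\<gamma> (k + t * m))"
  have a: "(?a has_vector_derivative m) (at t)" by (auto intro!: derivative_eq_intros)
  have chain_rule: "vector_derivative (\<lambda>t. g (k + t * m)) (at t) = m *\<^sub>R vector_derivative g (at (k + t * m))"
    if "g differentiable (at (k + t * m))" for g :: "real \<Rightarrow> 'c::real_normed_vector"
    using vector_derivative_chain_at[of ?a t g] that a vector_derivative_at[OF a]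
    by (simp add: o_def differentiableI_vector)
  have p: "?p \<in> topspace X" using assms by (simp add: regular_at_def)
  obtain U \<phi> where c: "chart_at ?p = (U, \<phi>)" by fastforce
  then have UA: "(U, \<phi>) \<in> A" "?p \<in> U" using chart_at[OF p] by auto
  let ?v = "vector_derivative (\<phi> \<circ> (snd \<circ> \<gamma>)) (at (k + t * m))"
  have "(\<phi> \<circ> (snd \<circ> \<gamma>)) differentiable (at (k + t * m))"
    using assms UA unfolding regular_at_def by force
  from chain_rule[OF this]
  have "speed_sq_within (\<lambda>t. snd (\<gamma> (k + t * m))) UNIV t = \<sigma> (U, \<phi>) ?p (m *\<^sub>R ?v) (m *\<^sub>R ?v)"
    using c by (simp add: speed_sq_within_def chart_speed_sq_def o_def Let_def)
  also have "\<dots> = m\<^sup>2 * \<sigma> (U, \<phi>) ?p ?v ?v"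
    using metric_bilinear[OF UA] by (simp add: bilinear_lmul bilinear_rmul power2_eq_square)
  also have "\<sigma> (U, \<phi>) ?p ?v ?v = speed_sq_within (snd \<circ> \<gamma>) UNIV (k + t * m)"
    using c by (simp add: speed_sq_within_def chart_speed_sq_def o_def Let_def)
  finally have s: "speed_sq_within (\<lambda>t. snd (\<gamma> (k + t * m))) UNIV t =
      m\<^sup>2 * speed_sq_within (snd \<circ> \<gamma>) UNIV (k + t * m)" .
  have d: "vector_derivative (\<lambda>t. fst (\<gamma> (k + t * m))) (at t) = m * vector_derivative (fst \<circ> \<gamma>) (at (k + t * m))"
    using chain_rule[of "fst \<circ> \<gamma>"] assms by (simp add: regular_at_def)
  have "warped_speed f (\<lambda>t. \<gamma> (k + t * m)) UNIV t =
      sqrt (m\<^sup>2 * ((vector_derivative (fst \<circ> \<gamma>) (at (k + t * m)))\<^sup>2 +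
        (f (fst (\<gamma> (k + t * m))))\<^sup>2 * speed_sq_within (snd \<circ> \<gamma>) UNIV (k + t * m)))"
    using d s by (simp add: warped_speed_def o_def power_mult_distrib algebra_simps)
  then show ?thesis by (simp add: warped_speed_def real_sqrt_mult)
qed

text \<open>
  The speed depends only on the germ of the curve; this identifies it on either side of the
  point where two curves have been concatenated.
\<close>

lemma warped_speed_local:
  assumes "open S" "t \<in> S" "\<And>s. s \<in> S \<Longrightarrow> \<gamma> s = \<eta> s"
  shows "warped_speed f \<gamma> UNIV t = warped_speed f \<eta> UNIV t"
proof -
  have ev: "\<forall>\<^sub>F s in nhds t. s \<in> UNIV \<longrightarrow> (g \<circ> \<gamma>) s = (g \<circ> \<eta>) s" for g :: "real \<times> 'a \<Rightarrow> 'c"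
    using eventually_mono[OF eventually_nhds_in_open[OF assms(1,2)]] assms(3) by simp
  have "vector_derivative (g \<circ> \<gamma>) (at t) = vector_derivative (g \<circ> \<eta>) (at t)"
    for g :: "real \<times> 'a \<Rightarrow> 'c::real_normed_vector"
    using vector_derivative_cong_eq[OF ev[of g] refl refl] by (simp add: o_def)
  from this[of fst] this[of "snd (chart_at (snd (\<eta> t))) \<circ> snd"] show ?thesis
    using assms(2,3) by (simp add: warped_speed_def speed_sq_within_def chart_speed_sq_def comp_assoc)
qed

lemma affine_image_interval:
  fixes m k a b :: real
  assumes "m \<noteq> 0" "a < b"
  shows "(\<lambda>t. k + t * m) ` {a..b} = (if 0 < m then {k + a * m..k + b * m} else {k + b * m..k + a * m})"
proof -
  have "(\<lambda>t. k + t * m) ` {a..b} = (\<lambda>t. m * t + k) ` {a..b}" by (simp add: algebra_simps)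
  then show ?thesis using assms image_affinity_atLeastAtMost[of m k a b] by (auto simp: algebra_simps)
qed

lemma integral_affine_reparametrization:
  assumes \<gamma>: "chain (cylinder_piece T \<gamma>) c d" and m: "m \<noteq> 0" and ab: "a < b"
    and im: "(\<lambda>t. k + t * m) ` {a..b} = {c..d}"
    and f: "warped_speed f \<gamma> UNIV integrable_on {c..d}"
  shows "integral {a..b} (warped_speed f (\<lambda>t. \<gamma> (k + t * m)) UNIV) = integral {c..d} (warped_speed f \<gamma> UNIV)"
proof -
  obtain S where S: "finite S" "\<forall>t\<in>{c..d} - S. regular_at \<gamma> t" using cylinder_chain_regular[OF \<gamma>] by blast
  have "(warped_speed f \<gamma> UNIV has_integral integral {c..d} (warped_speed f \<gamma> UNIV)) (cbox c d)"
    using f by (simp add: has_integral_iff)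
  from has_integral_affinity[OF this m, of k]
  have *: "((\<lambda>t. warped_speed f \<gamma> UNIV (k + t * m)) has_integral (1 / \<bar>m\<bar>) * integral {c..d} (warped_speed f \<gamma> UNIV))
      ((\<lambda>x. (1 / m) * x + - ((1 / m) * k)) ` {c..d})"
    by (simp add: algebra_simps)
  have "(\<lambda>x. (1 / m) * x + - ((1 / m) * k)) ` {c..d} = {a..b}"
    unfolding im[symmetric] image_image using m by (simp add: field_simps)
  with * have "((\<lambda>t. \<bar>m\<bar> * warped_speed f \<gamma> UNIV (k + t * m)) has_integral
      \<bar>m\<bar> * ((1 / \<bar>m\<bar>) * integral {c..d} (warped_speed f \<gamma> UNIV))) {a..b}"
    by (intro has_integral_mult_right) simp
  then have "((\<lambda>t. \<bar>m\<bar> * warped_speed f \<gamma> UNIV (k + t * m)) has_integral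
      integral {c..d} (warped_speed f \<gamma> UNIV)) {a..b}"
    using m by simp
  then have "(warped_speed f (\<lambda>t. \<gamma> (k + t * m)) UNIV has_integral
      integral {c..d} (warped_speed f \<gamma> UNIV)) {a..b}"
  proof (rule has_integral_spike_finite[rotated 2])
    show "finite ((\<lambda>t. k + t * m) -` S)"
      using m by (intro finite_vimageI[OF S(1)]) (auto simp: inj_on_def)
    fix t assume "t \<in> {a..b} - (\<lambda>t. k + t * m) -` S"
    then have "k + t * m \<in> {c..d} - S" using im by blast
    then show "warped_speed f (\<lambda>t. \<gamma> (k + t * m)) UNIV t = \<bar>m\<bar> * warped_speed f \<gamma> UNIV (k + t * m)"
      using S(2) warped_speed_affine by blast
  qed
  then show ?thesis by (rule integral_unique)
qed

lemma chain_reparametrize: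
  assumes "chain (cylinder_piece T \<gamma>) c d" "0 < m"
  shows "chain (cylinder_piece T (\<lambda>t. \<gamma> (k + t * m))) ((c - k) / m) ((d - k) / m)"
  using assms(1,2)
proof (rule chain_affine)
  fix a b :: real assume ab: "a < b" "cylinder_piece T \<gamma> (m * a + k) (m * b + k)"
  then show "cylinder_piece T (\<lambda>t. \<gamma> (k + t * m)) a b"
    using assms(2) affine_image_interval[of m a b k]
    by (intro cylinder_piece_affine[OF ab]) (simp add: algebra_simps)
qed

lemma chain_reverse_curve:
  assumes "chain (cylinder_piece T \<gamma>) c d"
  shows "chain (cylinder_piece T (\<lambda>t. \<gamma> (k + t * (-1)))) (k - d) (k - c)"
  using assms(1)
proof (rule chain_reverse)
  fix a b :: real assume ab: "a < b" "cylinder_piece T \<gamma> (k - b) (k - a)"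
  then show "cylinder_piece T (\<lambda>t. \<gamma> (k + t * (-1))) a b"
    using affine_image_interval[of "-1" a b k]
    by (intro cylinder_piece_affine[OF ab]) simp
qed

definition joins :: "real set \<Rightarrow> (real \<Rightarrow> real \<times> 'a) \<Rightarrow> real \<times> 'a \<Rightarrow> real \<times> 'a \<Rightarrow> bool" where
  "joins T \<gamma> p q \<longleftrightarrow> chain (cylinder_piece T \<gamma>) 0 1 \<and> \<gamma> 0 = p \<and> \<gamma> 1 = q"

text \<open>
  These are the conditions on a warping function under which all length integrals exist.
\<close>

definition admissible :: "real set \<Rightarrow> (real \<Rightarrow> real) \<Rightarrow> bool" where
  "admissible T f \<longleftrightarrow> f \<in> borel_measurable (restrict_space borel T) \<and> bounded (f ` T)"

lemma admissible_integrable: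
  assumes "admissible T f" "chain (cylinder_piece T \<gamma>) a b"
  shows "warped_speed f \<gamma> UNIV integrable_on {a..b}"
proof -
  obtain K where "\<And>x. x \<in> T \<Longrightarrow> \<bar>f x\<bar> \<le> K" using assms by (auto simp: admissible_def bounded_iff)
  then show ?thesis using assms by (intro warped_speed_integrable[of T \<gamma> a b f K]) (auto simp: admissible_def)
qed

lemma joins_reverse:
  assumes "joins T \<gamma> p q"
  shows "\<exists>\<eta>. joins T \<eta> q p \<and> (\<forall>f. admissible T f \<longrightarrow> warped_length A \<sigma> f \<eta> = warped_length A \<sigma> f \<gamma>)"
proof -
  let ?\<eta> = "\<lambda>t. \<gamma> (1 + t * (-1))"
  have \<gamma>: "chain (cylinder_piece T \<gamma>) 0 1" using assms by (simp add: joins_def)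
  have "joins T ?\<eta> q p" using chain_reverse_curve[OF \<gamma>, of 1] assms by (simp add: joins_def)
  moreover have "warped_length A \<sigma> f ?\<eta> = warped_length A \<sigma> f \<gamma>" if f: "admissible T f" for f
    unfolding warped_length_eq
    using affine_image_interval[of "-1" 0 1 1]
    by (intro integral_affine_reparametrization[OF \<gamma>] admissible_integrable[OF f \<gamma>]) auto
  ultimately show ?thesis by blast
qed

text \<open>
  The two curves are traversed at double speed, one after the other. The same concatenation works for
  all warping functions simultaneously.
\<close>

lemma joins_trans:
  assumes 1: "joins T \<gamma>\<^sub>1 p q" and 2: "joins T \<gamma>\<^sub>2 q r"
  shows "\<exists>\<eta>. joins T \<eta> p r \<and> (\<forall>f. admissible T f \<longrightarrow>
           warped_length A \<sigma> f \<eta> = warped_length A \<sigma> f \<gamma>\<^sub>1 + warped_length A \<sigma> f \<gamma>\<^sub>2)"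
proof -
  have c1: "chain (cylinder_piece T \<gamma>\<^sub>1) 0 1" and c2: "chain (cylinder_piece T \<gamma>\<^sub>2) 0 1"
    using assms by (auto simp: joins_def)
  let ?a = "\<lambda>t. \<gamma>\<^sub>1 (0 + t * 2)" and ?b = "\<lambda>t. \<gamma>\<^sub>2 (-1 + t * 2)"
  define \<eta> where "\<eta> t = (if t \<le> 1/2 then ?a t else ?b t)" for t
  have a: "\<eta> t = ?a t" if "t \<le> 1/2" for t using that by (simp add: \<eta>_def)
  have b: "\<eta> t = ?b t" if "1/2 \<le> t" for t
    using that 1 2 by (cases "t = 1/2") (auto simp: \<eta>_def joins_def)
  have "chain (cylinder_piece T ?a) 0 (1/2)" using chain_reparametrize[OF c1, of 2 0] by simp
  then have left: "chain (cylinder_piece T \<eta>) 0 (1/2)"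
    by (rule chain_mono) (use a cylinder_piece_cong[of _ _ \<eta> ?a] in auto)
  have "chain (cylinder_piece T ?b) (1/2) 1" using chain_reparametrize[OF c2, of 2 "-1"] by simp
  then have right: "chain (cylinder_piece T \<eta>) (1/2) 1"
    by (rule chain_mono) (use b cylinder_piece_cong[of _ _ \<eta> ?b] in auto)
  have c: "chain (cylinder_piece T \<eta>) 0 1" using left right by (rule chain.join)
  have "joins T \<eta> p r" using c 1 2 by (simp add: joins_def \<eta>_def)
  moreover have "warped_length A \<sigma> f \<eta> = warped_length A \<sigma> f \<gamma>\<^sub>1 + warped_length A \<sigma> f \<gamma>\<^sub>2"
    if f: "admissible T f" for f
  proof -
    let ?W = "\<lambda>\<gamma>. warped_speed f \<gamma> UNIV"
    have "warped_length A \<sigma> f \<eta> = integral {0..1/2} (?W \<eta>) + integral {1/2..1} (?W \<eta>)"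
      unfolding warped_length_eq
      using admissible_integrable[OF f c] by (subst Henstock_Kurzweil_Integration.integral_combine[symmetric, of 0 "1/2"]) auto
    also have "integral {0..1/2} (?W \<eta>) = integral {0..1/2} (?W ?a)"
    proof (rule integral_spike[of "{0, 1/2}"])
      fix t :: real assume "t \<in> {0..1/2} - {0, 1/2}"
      then show "?W ?a t = ?W \<eta> t" using a by (intro warped_speed_local[of "{..<1/2}"]) auto
    qed auto
    also have "\<dots> = warped_length A \<sigma> f \<gamma>\<^sub>1"
      unfolding warped_length_eq using affine_image_interval[of 2 0 "1/2" 0]
      by (intro integral_affine_reparametrization[OF c1] admissible_integrable[OF f c1]) auto
    also have "integral {1/2..1} (?W \<eta>) = integral {1/2..1} (?W ?b)"
    proof (rule integral_spike[of "{1/2, 1}"])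
      fix t :: real assume "t \<in> {1/2..1} - {1/2, 1}"
      then show "?W ?b t = ?W \<eta> t" using b by (intro warped_speed_local[of "{1/2<..}"]) auto
    qed auto
    also have "\<dots> = warped_length A \<sigma> f \<gamma>\<^sub>2"
      unfolding warped_length_eq using affine_image_interval[of 2 "1/2" 1 "-1"]
      by (intro integral_affine_reparametrization[OF c2] admissible_integrable[OF f c2]) auto
    finally show ?thesis .
  qed
  ultimately show ?thesis by blast
qed

end

section \<open>The Riemannian distance near a point\<close>

context riemannian_manifold
begin

text \<open>
  At the point \<open>p\<close> itself the lower bound \<open>l\<^sub>0\<close> comes from compactness of the unit sphere. In a small ball
  all coefficients of the metric differ from those at \<open>p\<close> by less than \<open>\<epsilon>\<close>, and \<open>\<epsilon>\<close> is chosen such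
  that this changes the form by at most \<open>l\<^sub>0 / 2\<close> times the squared norm.
\<close>

lemma metric_locally_comparable:
  assumes c: "(U, \<phi>) \<in> A" and p: "p \<in> U"
  shows "\<exists>r>0. \<exists>l>0. \<exists>L>0. ball (\<phi> p) r \<subseteq> \<phi> ` U \<and> (\<forall>x\<in>ball (\<phi> p) r. \<forall>v.
    l\<^sup>2 * (norm v)\<^sup>2 \<le> \<sigma> (U, \<phi>) (inv_into U \<phi> x) v v \<and>
    \<sigma> (U, \<phi>) (inv_into U \<phi> x) v v \<le> L\<^sup>2 * (norm v)\<^sup>2)"
proof -
  obtain B :: "'b set" where B: "finite B" "span B = UNIV" using finite_dim by blast
  obtain E :: "'b set" where E: "finite E" "\<And>e. e \<in> E \<Longrightarrow> norm e = 1" "\<And>v. v = (\<Sum>e\<in>E. (v \<bullet> e) *\<^sub>R e)"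
    using orthonormal_basis_exists[OF B] by blast
  define h where "h x d e = \<sigma> (U, \<phi>) (inv_into U \<phi> x) d e" for x d e
  have form: "h x v v = (\<Sum>(d, e)\<in>E\<times>E. (v \<bullet> d) * (v \<bullet> e) * h x d e)" if "x \<in> \<phi> ` U" for x v
    unfolding h_def using metric_bilinear[OF c] inv_into_into[OF that] by (intro bilinear_expand E(3)) auto
  have inv: "inv_into U \<phi> (\<phi> p) = p" using chart_inj[OF c] p by simp
  obtain l0 where l0: "0 < l0" "\<And>v. l0 * (norm v)\<^sup>2 \<le> h (\<phi> p) v v"
    using positive_definite_lower_bound[OF B metric_bilinear[OF c p] metric_pos[OF c p]] inv
    by (auto simp: h_def)
  \<comment> \<open>the summand 1 keeps the denominator positive in dimension 0\<close>
  define \<epsilon> where "\<epsilon> = l0 / (2 * (real (card (E \<times> E)) + 1))"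
  have \<epsilon>: "0 < \<epsilon>" "real (card (E \<times> E)) * \<epsilon> \<le> l0 / 2" using l0(1) by (auto simp: \<epsilon>_def field_simps)
  define M where "M = (\<Sum>(d, e)\<in>E\<times>E. \<bar>h (\<phi> p) d e\<bar>)"
  have M: "0 \<le> M" unfolding M_def by (intro sum_nonneg) auto
  have "\<forall>\<^sub>F x in nhds (\<phi> p). \<bar>h x d e - h (\<phi> p) d e\<bar> < \<epsilon>" for d e
  proof -
    have "continuous_on (\<phi> ` U) (\<lambda>x. h x d e)"
      using metric_smooth[OF c, unfolded smooth_on_def, rule_format, of 0] by (simp add: h_def)
    then have "isCont (\<lambda>x. h x d e) (\<phi> p)"
      using chart_image[OF c] p by (simp add: continuous_on_eq_continuous_at)
    then have "((\<lambda>x. h x d e) \<longlongrightarrow> h (\<phi> p) d e) (nhds (\<phi> p))" by (simp add: isCont_def tendsto_at_iff_tendsto_nhds[symmetric, of "\<lambda>x. h x d e"])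
    then show ?thesis using \<epsilon>(1) unfolding tendsto_iff dist_real_def by blast
  qed
  then have "\<forall>\<^sub>F x in nhds (\<phi> p). \<forall>(d, e)\<in>E \<times> E. \<bar>h x d e - h (\<phi> p) d e\<bar> < \<epsilon>"
    using E(1) by (intro eventually_ball_finite) auto
  moreover have "\<forall>\<^sub>F x in nhds (\<phi> p). x \<in> \<phi> ` U"
    using chart_image[OF c] p by (intro eventually_nhds_in_open) auto
  ultimately have "\<forall>\<^sub>F x in nhds (\<phi> p). x \<in> \<phi> ` U \<and> (\<forall>(d, e)\<in>E \<times> E. \<bar>h x d e - h (\<phi> p) d e\<bar> < \<epsilon>)"
    by eventually_elim simp
  then obtain r where r: "0 < r"
    "\<And>x. dist x (\<phi> p) < r \<Longrightarrow> x \<in> \<phi> ` U \<and> (\<forall>(d, e)\<in>E \<times> E. \<bar>h x d e - h (\<phi> p) d e\<bar> < \<epsilon>)"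
    unfolding eventually_nhds_metric by blast
  have prod: "\<bar>(v \<bullet> d) * (v \<bullet> e)\<bar> \<le> (norm v)\<^sup>2" if "d \<in> E" "e \<in> E" for v d e
  proof -
    have "\<bar>v \<bullet> d\<bar> \<le> norm v" "\<bar>v \<bullet> e\<bar> \<le> norm v"
      using Cauchy_Schwarz_ineq2[of v d] Cauchy_Schwarz_ineq2[of v e] E(2) that by auto
    then show ?thesis by (auto simp: abs_mult power2_eq_square intro: mult_mono)
  qed
  have bounds: "l0 / 2 * (norm v)\<^sup>2 \<le> h x v v \<and> h x v v \<le> (M + l0) * (norm v)\<^sup>2"
    if x: "x \<in> ball (\<phi> p) r" for x v
  proof -
    have xU: "x \<in> \<phi> ` U" and near: "\<And>d e. d \<in> E \<Longrightarrow> e \<in> E \<Longrightarrow> \<bar>h x d e - h (\<phi> p) d e\<bar> < \<epsilon>"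
      using r(2)[of x] x by (auto simp: dist_commute)
    have "h x v v - h (\<phi> p) v v = (\<Sum>(d, e)\<in>E\<times>E. (v \<bullet> d) * (v \<bullet> e) * (h x d e - h (\<phi> p) d e))"
      using form[OF xU] form[of "\<phi> p"] p
      by (simp add: case_prod_unfold sum_subtractf[symmetric] right_diff_distrib)
    also have "\<bar>\<dots>\<bar> \<le> (\<Sum>(d, e)\<in>E\<times>E. \<bar>(v \<bullet> d) * (v \<bullet> e) * (h x d e - h (\<phi> p) d e)\<bar>)"
      unfolding case_prod_unfold by (rule sum_abs)
    also have "\<dots> \<le> (\<Sum>(d, e)\<in>E\<times>E. (norm v)\<^sup>2 * \<epsilon>)"
    proof (rule sum_mono, clarify)
      fix d e assume de: "d \<in> E" "e \<in> E"
      show "\<bar>(v \<bullet> d) * (v \<bullet> e) * (h x d e - h (\<phi> p) d e)\<bar> \<le> (norm v)\<^sup>2 * \<epsilon>"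
        using prod[OF de, of v] near[OF de] by (subst abs_mult) (intro mult_mono, auto)
    qed
    also have "\<dots> = real (card (E \<times> E)) * \<epsilon> * (norm v)\<^sup>2" by (simp add: case_prod_unfold)
    also have "\<dots> \<le> l0 / 2 * (norm v)\<^sup>2" using \<epsilon>(2) by (rule mult_right_mono) simp
    finally have diff: "\<bar>h x v v - h (\<phi> p) v v\<bar> \<le> l0 / 2 * (norm v)\<^sup>2" .
    have "h (\<phi> p) v v \<le> (\<Sum>(d, e)\<in>E\<times>E. \<bar>(v \<bullet> d) * (v \<bullet> e) * h (\<phi> p) d e\<bar>)"
      using form[of "\<phi> p" v] p by (auto simp: case_prod_unfold intro: sum_mono)
    also have "\<dots> \<le> (\<Sum>(d, e)\<in>E\<times>E. (norm v)\<^sup>2 * \<bar>h (\<phi> p) d e\<bar>)"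
    proof (rule sum_mono, clarify)
      fix d e assume de: "d \<in> E" "e \<in> E"
      show "\<bar>(v \<bullet> d) * (v \<bullet> e) * h (\<phi> p) d e\<bar> \<le> (norm v)\<^sup>2 * \<bar>h (\<phi> p) d e\<bar>"
        using prod[OF de, of v] by (subst abs_mult) (intro mult_right_mono, auto)
    qed
    also have "\<dots> = M * (norm v)\<^sup>2" by (simp add: M_def case_prod_unfold sum_distrib_left mult.commute)
    finally have "h (\<phi> p) v v \<le> M * (norm v)\<^sup>2" .
    moreover have "0 \<le> l0 * (norm v)\<^sup>2" using l0(1) by simp
    ultimately show ?thesis using diff l0(2)[of v] unfolding distrib_right by linarith
  qed
  have "ball (\<phi> p) r \<subseteq> \<phi> ` U" using r(2) by (auto simp: dist_commute)
  moreover have "(sqrt (l0 / 2))\<^sup>2 = l0 / 2" "(sqrt (M + l0))\<^sup>2 = M + l0" "0 < sqrt (l0 / 2)" "0 < sqrt (M + l0)"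
    using l0(1) M by auto
  ultimately show ?thesis using r(1) bounds unfolding h_def by metis
qed

definition riem_length :: "(real \<Rightarrow> 'a) \<Rightarrow> real" where
  "riem_length \<alpha> = integral {0..1} (\<lambda>t. sqrt (speed_sq_within \<alpha> UNIV t))"

text \<open>
  Curves in the base are treated as cylinder curves of constant height, so that integrability and
  concatenation need to be proved only once.
\<close>

lemma lift_to_height:
  assumes "chain (base_piece \<alpha>) a b" "s \<in> T"
  shows "chain (cylinder_piece T (\<lambda>t. (s, \<alpha> t))) a b"
  using assms(1)
proof (rule chain_mono)
  fix a b :: real assume ab: "a < b" "base_piece \<alpha> a b"
  have "at t within {a..b} \<noteq> bot" if "t \<in> {a..b}" for t
    using at_within_relatively_open_nontrivial(2)[OF ab(1) openin_subtopology_self that] .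
  then have "smooth_on {a..b} (\<lambda>_. s)" by (rule smooth_on_const)
  then show "cylinder_piece T (\<lambda>t. (s, \<alpha> t)) a b"
    using ab assms(2) by (auto simp: cylinder_piece_def o_def)
qed

lemma warped_speed_lift:
  "warped_speed f (\<lambda>t. (s, \<alpha> t)) UNIV t = \<bar>f s\<bar> * sqrt (speed_sq_within \<alpha> UNIV t)"
  by (simp add: warped_speed_def o_def real_sqrt_mult)

lemma riem_speed_integrable:
  assumes "chain (base_piece \<alpha>) a b"
  shows "(\<lambda>t. sqrt (speed_sq_within \<alpha> UNIV t)) integrable_on {a..b}"
proof -
  have "warped_speed (\<lambda>_. 1) (\<lambda>t. (0, \<alpha> t)) UNIV integrable_on {a..b}"
    by (rule warped_speed_integrable[OF lift_to_height[OF assms], of 0 "{0}" _ 1]) auto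
  then show ?thesis by (simp add: warped_speed_lift[abs_def])
qed

lemma base_chain_regular:
  assumes "chain (base_piece \<alpha>) a b"
  shows "\<exists>S. finite S \<and> (\<forall>t\<in>{a..b} - S. \<alpha> t \<in> topspace X \<and> (\<forall>c\<in>A. \<alpha> t \<in> fst c \<longrightarrow>
    (snd c \<circ> \<alpha>) differentiable (at t) \<and> speed_sq_within \<alpha> UNIV t = chart_speed_sq c \<alpha> UNIV t))"
  using cylinder_chain_regular[OF lift_to_height[OF assms, of 0 "{0}"]] by (auto simp: regular_at_def o_def)

lemma base_chain_in_space: "chain (base_piece \<alpha>) a b \<Longrightarrow> t \<in> {a..b} \<Longrightarrow> \<alpha> t \<in> topspace X"
  using continuous_map_image_subset_topspace[OF base_chain_continuous[of \<alpha> a b]] by auto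

lemma riem_length_nonneg:
  assumes "chain (base_piece \<alpha>) 0 1"
  shows "0 \<le> riem_length \<alpha>"
  unfolding riem_length_def
  using base_chain_in_space[OF assms] by (intro integral_nonneg riem_speed_integrable[OF assms]) (auto intro!: speed_sq_within_nonneg)

lemma riem_dist_eq:
  assumes "p \<in> topspace X" "q \<in> topspace X"
  shows "riem_dist X A \<sigma> p q = Inf {riem_length \<alpha> |\<alpha>. chain (base_piece \<alpha>) 0 1 \<and> \<alpha> 0 = p \<and> \<alpha> 1 = q}"
  using assms by (simp add: riem_dist_def riem_length_eq piecewise_smooth_curve_iff_chain riem_length_def)

lemma riem_dist_le:
  assumes "chain (base_piece \<alpha>) 0 1"
  shows "riem_dist X A \<sigma> (\<alpha> 0) (\<alpha> 1) \<le> riem_length \<alpha>"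
proof -
  have "\<alpha> 0 \<in> topspace X" "\<alpha> 1 \<in> topspace X" using base_chain_in_space[OF assms] by auto
  then show ?thesis unfolding riem_dist_eq[OF \<open>\<alpha> 0 \<in> topspace X\<close> \<open>\<alpha> 1 \<in> topspace X\<close>]
    using assms riem_length_nonneg by (intro cInf_lower bdd_belowI[of _ 0]) auto
qed

text \<open>
  In every other chart the segment is a transition map restricted to an affine line, hence smooth.
\<close>

lemma chart_segment:
  assumes c: "(U, \<phi>) \<in> A" and seg: "\<And>t. t \<in> {0..1} \<Longrightarrow> x + t *\<^sub>R v \<in> \<phi> ` U"
  defines "\<alpha> \<equiv> \<lambda>t. inv_into U \<phi> (x + t *\<^sub>R v)"
  shows "base_piece \<alpha> 0 1"
    and "\<And>t. 0 < t \<Longrightarrow> t < 1 \<Longrightarrow> speed_sq_within \<alpha> UNIV t = \<sigma> (U, \<phi>) (\<alpha> t) v v"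
proof -
  have in_U: "\<alpha> t \<in> U" and chart: "\<phi> (\<alpha> t) = x + t *\<^sub>R v" if "t \<in> {0..1}" for t
    using seg[OF that] by (auto simp: \<alpha>_def inv_into_into f_inv_into_f)
  have "continuous_on {0..1} (\<lambda>t. x + t *\<^sub>R v)" by (intro continuous_intros)
  then have line: "continuous_map (top_of_set {0..1}) (top_of_set (\<phi> ` U)) (\<lambda>t. x + t *\<^sub>R v)"
    using seg by (auto simp: continuous_map_in_subtopology)
  have cont: "continuous_map (top_of_set {0..1}) X \<alpha>"
    using continuous_map_compose[OF line chart_inverse_continuous[OF c]] by (simp add: \<alpha>_def o_def)
  have "smooth_on {t \<in> {0..1}. \<alpha> t \<in> V} (\<psi> \<circ> \<alpha>)" if c': "(V, \<psi>) \<in> A" for V \<psi>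
  proof -
    let ?R = "{t \<in> {0..1}. \<alpha> t \<in> V}"
    have nontriv: "at t within ?R \<noteq> bot" if "t \<in> ?R" for t
      using at_within_relatively_open_nontrivial(2)[OF zero_less_one preimage_openin[OF cont chart_domain[OF c']] that] .
    have "x + t *\<^sub>R v \<in> \<phi> ` (U \<inter> V)" if "t \<in> ?R" for t
      using chart[of t] in_U[of t] that by (intro image_eqI[of _ _ "\<alpha> t"]) auto
    then have "smooth_on ?R (\<lambda>t. transition (U, \<phi>) (V, \<psi>) (x + t *\<^sub>R v))"
      by (intro smooth_on_along_line[OF charts_compatible[OF c c'] _ nontriv]) blast
    then show ?thesis by (simp add: transition_def \<alpha>_def o_def)
  qed
  then show piece: "base_piece \<alpha> 0 1" using cont by (auto simp: base_piece_def smooth_curve_on_def)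
  fix t :: real assume t: "0 < t" "t < 1"
  have "((\<lambda>t. x + t *\<^sub>R v) has_vector_derivative v) (at t within {0..1})"
    by (auto intro!: derivative_eq_intros)
  then have "((\<phi> \<circ> \<alpha>) has_vector_derivative v) (at t within {0..1})"
    by (rule has_vector_derivative_transform[rotated 2]) (use t chart in auto)
  then have "vector_derivative (\<phi> \<circ> \<alpha>) (at t within {0..1}) = v"
    using at_within_relatively_open_nontrivial(2)[OF zero_less_one openin_subtopology_self] t
    by (intro vector_derivative_within) auto
  then have "speed_sq_within \<alpha> {0..1} t = \<sigma> (U, \<phi>) (\<alpha> t) v v"
    using speed_sq_within_in_chart[OF zero_less_one piece, of t "(U, \<phi>)"] c in_U[of t] t
    by (simp add: chart_speed_sq_def)
  then show "speed_sq_within \<alpha> UNIV t = \<sigma> (U, \<phi>) (\<alpha> t) v v" using t by (simp add: speed_sq_within_interior)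
qed

text \<open>
  The straight segment between two points of a coordinate ball stays in the ball, where the metric is
  at most \<open>L\<^sup>2\<close> times the Euclidean one.
\<close>

lemma short_curve_in_chart:
  assumes c: "(U, \<phi>) \<in> A" and p: "p \<in> U" and q: "q \<in> U" "\<phi> q \<in> ball (\<phi> p) r"
    and r: "ball (\<phi> p) r \<subseteq> \<phi> ` U" and L: "0 < L"
    and upper: "\<And>x v. x \<in> ball (\<phi> p) r \<Longrightarrow> \<sigma> (U, \<phi>) (inv_into U \<phi> x) v v \<le> L\<^sup>2 * (norm v)\<^sup>2"
  shows "\<exists>\<alpha>. chain (base_piece \<alpha>) 0 1 \<and> \<alpha> 0 = p \<and> \<alpha> 1 = q \<and> riem_length \<alpha> \<le> L * norm (\<phi> q - \<phi> p)"
proof -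
  let ?v = "\<phi> q - \<phi> p"
  define \<alpha> where "\<alpha> t = inv_into U \<phi> (\<phi> p + t *\<^sub>R ?v)" for t
  have in_ball: "\<phi> p + t *\<^sub>R ?v \<in> ball (\<phi> p) r" if "t \<in> {0..1}" for t
  proof -
    have "norm (t *\<^sub>R ?v) \<le> norm ?v" using that by (simp add: mult_left_le_one_le)
    then show ?thesis using q(2) by (simp add: dist_norm norm_minus_commute)
  qed
  note seg = chart_segment[OF c, of "\<phi> p" ?v, folded \<alpha>_def]
  have piece: "chain (base_piece \<alpha>) 0 1"
    using seg(1) in_ball r by (intro chain.piece) (auto simp: subset_iff)
  have "riem_length \<alpha> \<le> integral {0..1} (\<lambda>t::real. L * norm ?v)"
    unfolding riem_length_def
  proof -
    \<comment> \<open>the speed of the segment is known only at interior parameters\<close>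
    have "integral {0..1} (\<lambda>t. sqrt (speed_sq_within \<alpha> UNIV t)) =
        integral {0..1} (\<lambda>t. if t \<in> {0<..<1} then sqrt (speed_sq_within \<alpha> UNIV t) else 0)"
      by (rule integral_spike[of "{0, 1}"]) auto
    also have "\<dots> \<le> integral {0..1} (\<lambda>t::real. L * norm ?v)"
    proof (rule integral_le)
      show "(\<lambda>t. if t \<in> {0<..<1} then sqrt (speed_sq_within \<alpha> UNIV t) else 0) integrable_on {0..1}"
        by (rule integrable_spike_finite[OF _ _ riem_speed_integrable[OF piece], of "{0, 1}"]) auto
      fix t :: real assume "t \<in> {0..1}"
      have "speed_sq_within \<alpha> UNIV t \<le> L\<^sup>2 * (norm ?v)\<^sup>2" if t: "0 < t" "t < 1"
      proof -
        have "speed_sq_within \<alpha> UNIV t = \<sigma> (U, \<phi>) (\<alpha> t) ?v ?v"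
          using in_ball r by (intro seg(2) t) blast
        then show ?thesis using upper[OF in_ball, of t ?v] t by (simp add: \<alpha>_def)
      qed
      then have "sqrt (speed_sq_within \<alpha> UNIV t) \<le> sqrt ((L * norm ?v)\<^sup>2)" if t: "0 < t" "t < 1"
        using t by (simp add: power_mult_distrib)
      then show "(if t \<in> {0<..<1} then sqrt (speed_sq_within \<alpha> UNIV t) else 0) \<le> L * norm ?v"
        using L by simp
    qed auto
    finally show "integral {0..1} (\<lambda>t. sqrt (speed_sq_within \<alpha> UNIV t)) \<le>
        integral {0..1} (\<lambda>t::real. L * norm ?v)" .
  qed
  moreover have "\<alpha> 0 = p" "\<alpha> 1 = q" using chart_inj[OF c] p q by (auto simp: \<alpha>_def)
  ultimately show ?thesis using piece by auto
qed

lemma chart_preimage_openin: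
  assumes "(U, \<phi>) \<in> A" "open B"
  shows "openin X {q \<in> U. \<phi> q \<in> B}"
proof -
  have "openin (subtopology X U) {q \<in> topspace (subtopology X U). \<phi> q \<in> B}"
    using openin_continuous_map_preimage[OF chart_continuous[OF assms(1)]] assms(2) by simp
  moreover have "{q \<in> topspace (subtopology X U). \<phi> q \<in> B} = {q \<in> U. \<phi> q \<in> B}"
    using chart_subset[OF assms(1)] by auto
  ultimately show ?thesis using openin_trans_full[OF _ chart_domain[OF assms(1)]] by simp
qed

lemma nearby_points:
  assumes p: "p \<in> topspace X" and \<epsilon>: "0 < \<epsilon>"
  shows "\<exists>N. openin X N \<and> p \<in> N \<and>
    (\<forall>q\<in>N. \<exists>\<alpha>. chain (base_piece \<alpha>) 0 1 \<and> \<alpha> 0 = p \<and> \<alpha> 1 = q \<and> riem_length \<alpha> < \<epsilon>)"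
proof -
  obtain U \<phi> where c: "(U, \<phi>) \<in> A" "p \<in> U" using p charts_cover by fastforce
  obtain r L where r: "0 < r" "ball (\<phi> p) r \<subseteq> \<phi> ` U" and L: "0 < L"
    and upper: "\<And>x v. x \<in> ball (\<phi> p) r \<Longrightarrow> \<sigma> (U, \<phi>) (inv_into U \<phi> x) v v \<le> L\<^sup>2 * (norm v)\<^sup>2"
    using metric_locally_comparable[OF c] by blast
  define N where "N = {q \<in> U. \<phi> q \<in> ball (\<phi> p) (min r (\<epsilon> / L))}"
  have "\<exists>\<alpha>. chain (base_piece \<alpha>) 0 1 \<and> \<alpha> 0 = p \<and> \<alpha> 1 = q \<and> riem_length \<alpha> < \<epsilon>" if q: "q \<in> N" for q
  proof -
    obtain \<alpha> where \<alpha>: "chain (base_piece \<alpha>) 0 1" "\<alpha> 0 = p" "\<alpha> 1 = q" "riem_length \<alpha> \<le> L * norm (\<phi> q - \<phi> p)"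
      using short_curve_in_chart[OF c _ _ r(2) L upper, of q] q by (auto simp: N_def)
    have "norm (\<phi> q - \<phi> p) < \<epsilon> / L" using q by (simp add: N_def dist_norm norm_minus_commute)
    then have "L * norm (\<phi> q - \<phi> p) < \<epsilon>" using L by (simp add: field_simps)
    then show ?thesis using \<alpha> by (intro exI[of _ \<alpha>]) simp
  qed
  moreover have "openin X N" unfolding N_def by (rule chart_preimage_openin[OF c(1)]) simp
  moreover have "p \<in> N" using c r(1) L \<epsilon> by (simp add: N_def)
  ultimately show ?thesis by blast
qed

lemma base_trans:
  assumes "chain (base_piece \<alpha>) 0 1" "chain (base_piece \<beta>) 0 1" "\<alpha> 1 = \<beta> 0"
  shows "\<exists>\<eta>. chain (base_piece \<eta>) 0 1 \<and> \<eta> 0 = \<alpha> 0 \<and> \<eta> 1 = \<beta> 1"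
proof -
  have "joins {0} (\<lambda>t. (0, \<alpha> t)) (0, \<alpha> 0) (0, \<alpha> 1)" "joins {0} (\<lambda>t. (0, \<beta> t)) (0, \<alpha> 1) (0, \<beta> 1)"
    using assms lift_to_height by (auto simp: joins_def)
  from joins_trans[OF this] obtain \<eta> where "joins {0} \<eta> (0, \<alpha> 0) (0, \<beta> 1)" by blast
  then show ?thesis using cylinder_chain_base[of "{0}" \<eta>] by (intro exI[of _ "snd \<circ> \<eta>"]) (auto simp: joins_def)
qed

lemma base_sym:
  assumes "chain (base_piece \<alpha>) 0 1"
  shows "\<exists>\<eta>. chain (base_piece \<eta>) 0 1 \<and> \<eta> 0 = \<alpha> 1 \<and> \<eta> 1 = \<alpha> 0"
proof -
  have "joins {0} (\<lambda>t. (0, \<alpha> t)) (0, \<alpha> 0) (0, \<alpha> 1)"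
    using assms lift_to_height by (auto simp: joins_def)
  from joins_reverse[OF this] obtain \<eta> where "joins {0} \<eta> (0, \<alpha> 1) (0, \<alpha> 0)" by blast
  then show ?thesis using cylinder_chain_base[of "{0}" \<eta>] by (intro exI[of _ "snd \<circ> \<eta>"]) (auto simp: joins_def)
qed

text \<open>
  Being joined by a curve is an equivalence relation whose classes are open, because nearby points are
  joined inside a chart; a connected space has only one class.
\<close>

lemma points_joined_by_curve:
  assumes conn: "connected_space X" and pq: "p \<in> topspace X" "q \<in> topspace X"
  shows "\<exists>\<alpha>. chain (base_piece \<alpha>) 0 1 \<and> \<alpha> 0 = p \<and> \<alpha> 1 = q"
proof -
  define J where "J x y \<longleftrightarrow> (\<exists>\<alpha>. chain (base_piece \<alpha>) 0 1 \<and> \<alpha> 0 = x \<and> \<alpha> 1 = y)" for x y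
  have trans: "J x y \<Longrightarrow> J y z \<Longrightarrow> J x z" for x y z unfolding J_def using base_trans by metis
  have sym: "J x y \<Longrightarrow> J y x" for x y unfolding J_def using base_sym by metis
  have near: "\<exists>N. openin X N \<and> x \<in> N \<and> (\<forall>y\<in>N. J x y)" if "x \<in> topspace X" for x
    using nearby_points[OF that zero_less_one] unfolding J_def by blast
  let ?C = "{x \<in> topspace X. J p x}"
  have "openin X ?C"
  proof (subst openin_subopen, intro ballI)
    fix x assume x: "x \<in> ?C"
    then obtain N where N: "openin X N" "x \<in> N" "\<forall>y\<in>N. J x y" using near by blast
    then have "N \<subseteq> ?C" using x trans openin_subset[OF N(1)] by blast
    then show "\<exists>T. openin X T \<and> x \<in> T \<and> T \<subseteq> ?C" using N by blast
  qed
  moreover have "openin X (topspace X - ?C)"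
  proof (subst openin_subopen, intro ballI)
    fix x assume x: "x \<in> topspace X - ?C"
    then obtain N where N: "openin X N" "x \<in> N" "\<forall>y\<in>N. J x y" using near by blast
    then have "N \<subseteq> topspace X - ?C" using x trans sym openin_subset[OF N(1)] by blast
    then show "\<exists>T. openin X T \<and> x \<in> T \<and> T \<subseteq> topspace X - ?C" using N by blast
  qed
  ultimately have "?C = {} \<or> ?C = topspace X"
    using conn by (auto simp: connected_space_clopen_in closedin_def)
  moreover have "p \<in> ?C" using near[OF pq(1)] pq(1) by blast
  ultimately show ?thesis using pq(2) unfolding J_def by blast
qed

lemma riem_dist_nonneg:
  assumes "connected_space X"
  shows "0 \<le> riem_dist X A \<sigma> p q"
proof (cases "p \<in> topspace X \<and> q \<in> topspace X")
  case True
  show ?thesis unfolding riem_dist_eq[OF True[THEN conjunct1] True[THEN conjunct2]]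
    using points_joined_by_curve[OF assms] True riem_length_nonneg by (intro cInf_greatest) blast+
qed (auto simp: riem_dist_def)

text \<open>
  Let \<open>T\<close> be the first time at which the curve is outside the open coordinate ball of radius \<open>\<rho>\<close>. The
  closed coordinate ball is compact, hence closed in the Hausdorff space \<open>X\<close>, so that at time \<open>T\<close> the
  curve is still in the chart and lies on the sphere of radius \<open>\<rho>\<close>. Up to this time the component of
  the curve in the direction \<open>u\<close> of its exit point grows from its initial value by \<open>\<rho>\<close>, and its
  derivative is at most the Euclidean speed, which is at most \<open>1 / l\<close> times the Riemannian speed.
\<close>

lemma curve_leaving_chart_ball:
  assumes c: "(U, \<phi>) \<in> A" and p: "p \<in> U"
    and r: "ball (\<phi> p) r \<subseteq> \<phi> ` U" and l: "0 < l"
    and lower: "\<And>x v. x \<in> ball (\<phi> p) r \<Longrightarrow> l\<^sup>2 * (norm v)\<^sup>2 \<le> \<sigma> (U, \<phi>) (inv_into U \<phi> x) v v"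
    and \<rho>: "0 < \<rho>" "\<rho> < r"
    and \<alpha>: "chain (base_piece \<alpha>) 0 1" "\<alpha> 0 = p" "\<not> (\<alpha> 1 \<in> U \<and> \<phi> (\<alpha> 1) \<in> ball (\<phi> p) \<rho>)"
  shows "l * \<rho> \<le> riem_length \<alpha>"
proof -
  define V where "V = {q \<in> U. \<phi> q \<in> ball (\<phi> p) \<rho>}"
  have V: "openin X V" unfolding V_def by (rule chart_preimage_openin[OF c]) simp
  note cont = base_chain_continuous[OF \<alpha>(1)]
  define S where "S = {t \<in> {0..1}. \<alpha> t \<in> topspace X - V}"
  have "closedin (top_of_set {0..1}) S"
    using closedin_continuous_map_preimage[OF cont, of "topspace X - V"] V
    by (simp add: S_def closedin_diff)
  then have closed: "closed S" using closedin_closed_trans closed_atLeastAtMost by blast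
  have S1: "1 \<in> S" using \<alpha>(3) base_chain_in_space[OF \<alpha>(1)] by (simp add: S_def V_def)
  define T where "T = Inf S"
  have bdd: "bdd_below S" unfolding S_def by (rule bdd_belowI[of _ 0]) auto
  have T: "T \<in> S" unfolding T_def using closed bdd S1 by (intro closed_contains_Inf) auto
  have before: "\<alpha> t \<in> V" if "0 \<le> t" "t < T" for t
  proof (rule ccontr)
    assume "\<alpha> t \<notin> V"
    moreover have "t \<le> 1" using that T by (simp add: S_def)
    ultimately have "t \<in> S" using that base_chain_in_space[OF \<alpha>(1)] by (simp add: S_def)
    then have "T \<le> t" unfolding T_def using bdd by (rule cInf_lower)
    then show False using that by simp
  qed
  have T01: "0 < T" "T \<le> 1"
  proof -
    have "T \<noteq> 0" using T \<alpha>(2) p \<rho>(1) by (auto simp: S_def V_def)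
    then show "0 < T" "T \<le> 1" using T by (auto simp: S_def)
  qed
  define K where "K = inv_into U \<phi> ` cball (\<phi> p) \<rho>"
  have cball: "cball (\<phi> p) \<rho> \<subseteq> \<phi> ` U" using r \<rho> by (auto simp: subset_iff)
  obtain B :: "'b set" where B: "finite B" "span B = UNIV" using finite_dim by blast
  have "compactin (top_of_set (\<phi> ` U)) (cball (\<phi> p) \<rho>)"
    using compact_cball_finite_dim[OF B] cball by (simp add: compactin_subtopology)
  then have "compactin X K"
    unfolding K_def by (rule image_compactin[OF _ chart_inverse_continuous[OF c]])
  then have "closedin X K" using Hausdorff compactin_imp_closedin by blast
  then have "closedin (top_of_set {0..1}) {t \<in> {0..1}. \<alpha> t \<in> K}"
    using closedin_continuous_map_preimage[OF cont] by simp
  then have closedK: "closed {t \<in> {0..1}. \<alpha> t \<in> K}" using closedin_closed_trans closed_atLeastAtMost by blast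
  have VK: "V \<subseteq> K"
  proof
    fix q assume "q \<in> V"
    then show "q \<in> K" unfolding K_def using chart_inj[OF c]
      by (intro image_eqI[of _ _ "\<phi> q"]) (auto simp: V_def)
  qed
  have "{0..<T} \<subseteq> {t \<in> {0..1}. \<alpha> t \<in> K}" using before VK T01 by auto
  then have "closure {0..<T} \<subseteq> {t \<in> {0..1}. \<alpha> t \<in> K}" using closedK by (rule closure_minimal)
  moreover have "T \<in> closure {0..<T}" using T01 by (simp add: closure_atLeastLessThan)
  ultimately have "\<alpha> T \<in> K" by blast
  then obtain x where x: "x \<in> cball (\<phi> p) \<rho>" "\<alpha> T = inv_into U \<phi> x" by (auto simp: K_def)
  then have \<alpha>T: "\<alpha> T \<in> U" "\<phi> (\<alpha> T) \<in> cball (\<phi> p) \<rho>"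
    using cball by (auto simp: inv_into_into f_inv_into_f subset_iff)
  moreover have "\<phi> (\<alpha> T) \<notin> ball (\<phi> p) \<rho>" using T \<alpha>T(1) by (auto simp: S_def V_def)
  ultimately have norm_T: "norm (\<phi> (\<alpha> T) - \<phi> p) = \<rho>" by (simp add: dist_norm norm_minus_commute)
  have in_U: "\<alpha> t \<in> U" and in_ball: "\<phi> (\<alpha> t) \<in> ball (\<phi> p) r" if "t \<in> {0..T}" for t
    using before[of t] \<alpha>T that \<rho> by (cases "t = T"; force simp: V_def)+
  define u where "u = (\<phi> (\<alpha> T) - \<phi> p) /\<^sub>R \<rho>"
  have u: "norm u = 1" using norm_T \<rho> by (simp add: u_def)
  obtain F where F: "finite F" "\<And>t. t \<in> {0..1} - F \<Longrightarrow> \<alpha> t \<in> U \<Longrightarrow> (\<phi> \<circ> \<alpha>) differentiable (at t) \<and>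
      speed_sq_within \<alpha> UNIV t = chart_speed_sq (U, \<phi>) \<alpha> UNIV t"
    using base_chain_regular[OF \<alpha>(1)] c by fastforce
  define g where "g t = u \<bullet> \<phi> (\<alpha> t)" for t
  define v where "v t = vector_derivative (\<phi> \<circ> \<alpha>) (at t)" for t
  have "continuous_map (top_of_set {0..T}) X \<alpha>"
    by (rule continuous_map_from_subtopology_mono[OF cont]) (use T01 in auto)
  then have "continuous_map (top_of_set {0..T}) (subtopology X U) \<alpha>"
    using in_U by (auto simp: continuous_map_in_subtopology)
  from continuous_map_compose[OF this chart_continuous[OF c]]
  have "continuous_on {0..T} (\<lambda>t. \<phi> (\<alpha> t))" by (simp add: o_def)
  then have g_cont: "continuous_on {0..T} g" unfolding g_def by (intro continuous_intros)
  have g_deriv: "(g has_vector_derivative u \<bullet> v t) (at t)" if t: "t \<in> {0<..<T} - F" for t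
  proof -
    have "((\<lambda>t. \<phi> (\<alpha> t)) has_vector_derivative v t) (at t)"
      using F(2)[of t] in_U[of t] t T01 by (simp add: v_def vector_derivative_works o_def)
    then show ?thesis unfolding g_def
      by (rule bounded_linear.has_vector_derivative[OF bounded_linear_inner_right])
  qed
  have "((\<lambda>t. u \<bullet> v t) has_integral g T - g 0) {0..T}"
    using F(1) T01 g_deriv g_cont by (intro fundamental_theorem_of_calculus_interior_strong[of F]) auto
  moreover have "g T - g 0 = \<rho>"
  proof -
    have "g T - g 0 = ((\<phi> (\<alpha> T) - \<phi> p) \<bullet> (\<phi> (\<alpha> T) - \<phi> p)) / \<rho>"
      using \<alpha>(2) unfolding g_def u_def inner_diff_right[symmetric] inner_scaleR_left
      by (simp add: divide_inverse inner_diff_right algebra_simps)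
    then show ?thesis using norm_T \<rho> by (simp add: dot_square_norm power2_eq_square)
  qed
  ultimately have int: "((\<lambda>t. l * (u \<bullet> v t)) has_integral l * \<rho>) {0..T}"
    by (metis has_integral_mult_right)
  let ?s = "\<lambda>t. sqrt (speed_sq_within \<alpha> UNIV t)"
  have s_int: "?s integrable_on {0..1}" by (rule riem_speed_integrable[OF \<alpha>(1)])
  have s_int_T: "?s integrable_on {0..T}" using s_int by (rule integrable_on_subinterval) (use T01 in auto)
  have s0: "0 \<le> ?s t" if "t \<in> {0..1}" for t
    using base_chain_in_space[OF \<alpha>(1) that] by (simp add: speed_sq_within_nonneg)
  have le: "l * (u \<bullet> v t) \<le> ?s t" if t: "t \<in> {0..T} - F" for t
  proof -
    have tU: "t \<in> {0..1} - F" "t \<in> {0..T}" using t T01 by auto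
    have "\<bar>u \<bullet> v t\<bar> \<le> norm (v t)" using Cauchy_Schwarz_ineq2[of u "v t"] u by simp
    then have "l * (u \<bullet> v t) \<le> sqrt (l\<^sup>2 * (norm (v t))\<^sup>2)"
      using l by (simp add: real_sqrt_mult abs_le_iff)
    also have "l\<^sup>2 * (norm (v t))\<^sup>2 \<le> \<sigma> (U, \<phi>) (inv_into U \<phi> (\<phi> (\<alpha> t))) (v t) (v t)"
      using in_ball[OF tU(2)] by (rule lower)
    also have "\<dots> = speed_sq_within \<alpha> UNIV t"
      using F(2)[OF tU(1) in_U[OF tU(2)]] in_U[OF tU(2)] chart_inj[OF c] by (simp add: chart_speed_sq_def v_def Let_def)
    finally show ?thesis by simp
  qed
  have "l * \<rho> = integral {0..T} (\<lambda>t. l * (u \<bullet> v t))" using integral_unique[OF int] by (rule sym)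
  also have "\<dots> = integral {0..T} (\<lambda>t. if t \<in> F then ?s t else l * (u \<bullet> v t))"
    by (rule integral_spike[of F]) (use F(1) in auto)
  also have "\<dots> \<le> integral {0..T} ?s"
  proof (rule integral_le[OF _ s_int_T])
    show "(\<lambda>t. if t \<in> F then ?s t else l * (u \<bullet> v t)) integrable_on {0..T}"
      by (rule integrable_spike_finite[OF F(1) _ has_integral_integrable[OF int]]) auto
  qed (use le in auto)
  also have "\<dots> \<le> integral {0..1} ?s"
    using s_int s_int_T s0 T01 by (intro integral_subset_le) auto
  finally show ?thesis by (simp add: riem_length_def)
qed

text \<open>
  A coordinate ball around \<open>p\<close> that does not contain \<open>q\<close> has to be left by every curve from \<open>p\<close> to \<open>q\<close>.
\<close>

lemma riem_dist_pos:
  assumes conn: "connected_space X" and pq: "p \<in> topspace X" "q \<in> topspace X" "p \<noteq> q"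
  shows "0 < riem_dist X A \<sigma> p q"
proof -
  obtain U \<phi> where c: "(U, \<phi>) \<in> A" "p \<in> U" using pq charts_cover by fastforce
  obtain r l where r: "0 < r" "ball (\<phi> p) r \<subseteq> \<phi> ` U" and l: "0 < l"
    and lower: "\<And>x v. x \<in> ball (\<phi> p) r \<Longrightarrow> l\<^sup>2 * (norm v)\<^sup>2 \<le> \<sigma> (U, \<phi>) (inv_into U \<phi> x) v v"
    using metric_locally_comparable[OF c] by blast
  define \<rho> where "\<rho> = (if q \<in> U then min (r / 2) (norm (\<phi> q - \<phi> p)) else r / 2)"
  have "\<phi> q \<noteq> \<phi> p" if "q \<in> U" using chart_inj[OF c(1)] c(2) that pq(3) by (auto dest: inj_onD)
  then have \<rho>: "0 < \<rho>" "\<rho> < r" using r by (auto simp: \<rho>_def)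
  have q: "\<not> (q \<in> U \<and> \<phi> q \<in> ball (\<phi> p) \<rho>)" by (auto simp: \<rho>_def dist_norm norm_minus_commute)
  have "l * \<rho> \<le> riem_dist X A \<sigma> p q"
    unfolding riem_dist_eq[OF pq(1,2)]
  proof (rule cInf_greatest)
    show "{riem_length \<alpha> |\<alpha>. chain (base_piece \<alpha>) 0 1 \<and> \<alpha> 0 = p \<and> \<alpha> 1 = q} \<noteq> {}"
      using points_joined_by_curve[OF conn pq(1,2)] by blast
    fix y assume "y \<in> {riem_length \<alpha> |\<alpha>. chain (base_piece \<alpha>) 0 1 \<and> \<alpha> 0 = p \<and> \<alpha> 1 = q}"
    then show "l * \<rho> \<le> y"
      using curve_leaving_chart_ball[OF c r(2) l lower \<rho>] q by blast
  qed
  then show ?thesis using l \<rho> by (meson mult_pos_pos order.strict_trans2)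
qed

end

section \<open>Warped distances\<close>

context riemannian_manifold
begin

lemma joins_in_cylinder:
  assumes "joins T \<gamma> p q" "t \<in> {0..1}"
  shows "fst (\<gamma> t) \<in> T" "snd (\<gamma> t) \<in> topspace X"
  using cylinder_chain_height[of T \<gamma> 0 1] base_chain_in_space[OF cylinder_chain_base, of T \<gamma> 0 1 t] assms
  by (auto simp: joins_def image_subset_iff)

lemma warped_length_nonneg:
  assumes "admissible T f" "joins T \<gamma> p q"
  shows "0 \<le> warped_length A \<sigma> f \<gamma>"
  unfolding warped_length_eq
proof (rule integral_nonneg)
  show "warped_speed f \<gamma> UNIV integrable_on {0..1}"
    using assms admissible_integrable by (auto simp: joins_def)
  show "0 \<le> warped_speed f \<gamma> UNIV t" if "t \<in> {0..1}" for t
    using joins_in_cylinder[OF assms(2) that] speed_sq_within_nonneg[of "snd \<circ> \<gamma>" t UNIV]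
    by (simp add: warped_speed_def)
qed

text \<open>
  The vector \<open>(\<xi>, s)\<close> consists of the vertical speed and the Riemannian speed of the projection; its
  integral is \<open>(\<Delta>, L)\<close>, of norm \<open>R\<close>. The integrand dominates \<open>c\<close> times the norm of \<open>(\<xi>, s)\<close>, hence by
  Cauchy-Schwarz \<open>c\<close> times its component along the unit vector \<open>(u, v)\<close> in the direction of \<open>(\<Delta>, L)\<close>,
  and this component integrates to \<open>R\<close>.
\<close>

lemma warped_length_lower_bound:
  assumes f: "admissible T f" "\<And>x. x \<in> T \<Longrightarrow> c \<le> f x" and c: "0 < c" "c \<le> 1"
    and \<gamma>: "joins T \<gamma> p q"
  shows "c * sqrt ((fst q - fst p)\<^sup>2 + (riem_length (snd \<circ> \<gamma>))\<^sup>2) \<le> warped_length A \<sigma> f \<gamma>"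
proof -
  have chain: "chain (cylinder_piece T \<gamma>) 0 1" using \<gamma> by (simp add: joins_def)
  define \<xi> where "\<xi> t = vector_derivative (fst \<circ> \<gamma>) (at t)" for t
  define s where "s t = sqrt (speed_sq_within (snd \<circ> \<gamma>) UNIV t)" for t
  define \<Delta> where "\<Delta> = fst q - fst p"
  define L where "L = riem_length (snd \<circ> \<gamma>)"
  define R where "R = sqrt (\<Delta>\<^sup>2 + L\<^sup>2)"
  obtain F where F: "finite F" "\<And>t. t \<in> {0..1} - F \<Longrightarrow> regular_at \<gamma> t"
    using cylinder_chain_regular[OF chain] by blast
  have \<xi>: "(\<xi> has_integral \<Delta>) {0..1}"
  proof -
    have "((fst \<circ> \<gamma>) has_vector_derivative \<xi> t) (at t)" if "t \<in> {0<..<1} - F" for t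
      using F(2)[of t] that by (simp add: regular_at_def \<xi>_def vector_derivative_works)
    then have "(\<xi> has_integral (fst \<circ> \<gamma>) 1 - (fst \<circ> \<gamma>) 0) {0..1}"
      using F(1) cylinder_chain_height[OF chain] zero_le_one by (intro fundamental_theorem_of_calculus_interior_strong) blast+
    then show ?thesis using \<gamma> by (simp add: \<Delta>_def joins_def)
  qed
  have s: "(s has_integral L) {0..1}"
    using riem_speed_integrable[OF cylinder_chain_base[OF chain]]
    unfolding L_def riem_length_def s_def has_integral_iff by simp
  have W: "warped_speed f \<gamma> UNIV integrable_on {0..1}" by (rule admissible_integrable[OF f(1) chain])
  show ?thesis
  proof (cases "R = 0")
    case True
    then show ?thesis using warped_length_nonneg[OF f(1) \<gamma>] by (simp add: R_def \<Delta>_def L_def)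
  next
    case False
    moreover have "0 \<le> R" by (simp add: R_def)
    ultimately have "0 < R" by simp
    moreover have "R\<^sup>2 = \<Delta>\<^sup>2 + L\<^sup>2" by (simp add: R_def)
    ultimately have R: "0 < R" "R\<^sup>2 = \<Delta>\<^sup>2 + L\<^sup>2" by blast+
    define u v where "u = \<Delta> / R" and "v = L / R"
    have uv: "u\<^sup>2 + v\<^sup>2 = 1"
    proof -
      have "u\<^sup>2 + v\<^sup>2 = (\<Delta>\<^sup>2 + L\<^sup>2) / R\<^sup>2" by (simp add: u_def v_def power_divide add_divide_distrib)
      then show ?thesis using R(1) unfolding R(2)[symmetric] by simp
    qed
    have "c * (u * \<xi> t + v * s t) \<le> warped_speed f \<gamma> UNIV t" if t: "t \<in> {0..1}" for t
    proof -
      note in_cyl = joins_in_cylinder[OF \<gamma> t]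
      have S: "0 \<le> speed_sq_within (snd \<circ> \<gamma>) UNIV t" using in_cyl by (simp add: speed_sq_within_nonneg)
      \<comment> \<open>Cauchy-Schwarz in the plane, from the Lagrange identity\<close>
      have "(\<xi> t * v - s t * u)\<^sup>2 \<ge> 0" by simp
      then have "(u * \<xi> t + v * s t)\<^sup>2 \<le> (u\<^sup>2 + v\<^sup>2) * ((\<xi> t)\<^sup>2 + (s t)\<^sup>2)"
        by (simp add: power2_eq_square algebra_simps)
      then have "(c * (u * \<xi> t + v * s t))\<^sup>2 \<le> c\<^sup>2 * ((\<xi> t)\<^sup>2 + (s t)\<^sup>2)"
        using uv by (simp add: power_mult_distrib mult_left_mono)
      also have "\<dots> \<le> (\<xi> t)\<^sup>2 + (f (fst (\<gamma> t)))\<^sup>2 * (s t)\<^sup>2"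
      proof -
        \<comment> \<open>the vertical part is not weighted by \<open>f\<close>, so \<open>c \<le> 1\<close> is what makes it fit\<close>
        have "c\<^sup>2 \<le> 1" using c power_mono[of c 1 2] by simp
        then have "c\<^sup>2 * (\<xi> t)\<^sup>2 \<le> (\<xi> t)\<^sup>2" by (simp add: mult_left_le_one_le)
        moreover have "c\<^sup>2 \<le> (f (fst (\<gamma> t)))\<^sup>2" using f(2)[OF in_cyl(1)] c by (intro power_mono) auto
        then have "c\<^sup>2 * (s t)\<^sup>2 \<le> (f (fst (\<gamma> t)))\<^sup>2 * (s t)\<^sup>2" by (rule mult_right_mono) simp
        ultimately show ?thesis by (simp add: distrib_left)
      qed
      finally have "c * (u * \<xi> t + v * s t) \<le> sqrt ((\<xi> t)\<^sup>2 + (f (fst (\<gamma> t)))\<^sup>2 * (s t)\<^sup>2)"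
        by (rule real_le_rsqrt)
      then show ?thesis using S by (simp add: warped_speed_def \<xi>_def s_def)
    qed
    moreover have "((\<lambda>t. c * (u * \<xi> t + v * s t)) has_integral c * (u * \<Delta> + v * L)) {0..1}"
      by (rule has_integral_mult_right[OF has_integral_add[OF has_integral_mult_right[OF \<xi>] has_integral_mult_right[OF s]]])
    ultimately have "c * (u * \<Delta> + v * L) \<le> warped_length A \<sigma> f \<gamma>"
      unfolding warped_length_eq using has_integral_le[OF _ integrable_integral[OF W]] by blast
    moreover have "u * \<Delta> + v * L = R"
    proof -
      have "u * \<Delta> + v * L = (\<Delta>\<^sup>2 + L\<^sup>2) / R"
        by (simp add: u_def v_def power2_eq_square add_divide_distrib)
      then show ?thesis using R(1) unfolding R(2)[symmetric] by (simp add: power2_eq_square)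
    qed
    ultimately show ?thesis by (simp add: R_def \<Delta>_def L_def)
  qed
qed

lemma vertical_curve:
  assumes "x \<in> {t0..t1}" "y \<in> {t0..t1}" "p \<in> topspace X"
  shows "\<exists>\<gamma>. joins {t0..t1} \<gamma> (x, p) (y, p) \<and> warped_length A \<sigma> f \<gamma> = \<bar>y - x\<bar>"
proof -
  define \<gamma> where "\<gamma> t = (x + t * (y - x), p)" for t :: real
  have nontriv: "at t within R \<noteq> bot" if "openin (top_of_set {0..1}) R" "t \<in> R" for t :: real and R
    using at_within_relatively_open_nontrivial(2)[OF zero_less_one that] .
  have "smooth_on {t \<in> {0..1::real}. p \<in> U} (\<phi> \<circ> (\<lambda>_. p))" for U and \<phi> :: "'a \<Rightarrow> 'b"
  proof (cases "p \<in> U")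
    case True
    have "smooth_on {0..1::real} (\<lambda>_. \<phi> p)" by (rule smooth_on_const[OF nontriv[OF openin_subtopology_self]])
    then show ?thesis using True by (simp add: o_def del: atLeastAtMost_iff)
  qed (use smooth_on_const[of "{} :: real set"] in \<open>simp add: o_def\<close>)
  then have "smooth_curve_on A 0 1 (\<lambda>_. p)" by (auto simp: smooth_curve_on_def)
  then have "base_piece (\<lambda>_. p) 0 1" using assms(3) by (simp add: base_piece_def)
  moreover have "smooth_on {0..1} (\<lambda>t. x + t *\<^sub>R (y - x))"
    using nontriv[OF openin_subtopology_self] by (intro smooth_on_line) blast
  moreover have "x + t * (y - x) \<in> {t0..t1}" if "t \<in> {0..1}" for t
  proof -
    have "(1 - t) *\<^sub>R x + t *\<^sub>R y \<in> {t0..t1}"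
      using assms(1,2) that by (intro convexD_alt) auto
    then show ?thesis by (simp add: algebra_simps)
  qed
  ultimately have "cylinder_piece {t0..t1} \<gamma> 0 1"
    by (auto simp: cylinder_piece_def \<gamma>_def o_def)
  then have "joins {t0..t1} \<gamma> (x, p) (y, p)" by (simp add: joins_def chain.piece \<gamma>_def)
  moreover have "warped_speed f \<gamma> UNIV t = \<bar>y - x\<bar>" for t
  proof -
    have "((\<lambda>t. x + t * (y - x)) has_vector_derivative (y - x)) (at t)"
      by (auto intro!: derivative_eq_intros)
    then have "vector_derivative (fst \<circ> \<gamma>) (at t) = y - x"
      by (simp add: \<gamma>_def o_def vector_derivative_at)
    moreover have "speed_sq_within (snd \<circ> \<gamma>) UNIV t = 0"
      using chart_at[OF assms(3)] metric_bilinear[of "fst (chart_at p)" "snd (chart_at p)" p]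
      by (simp add: speed_sq_within_def chart_speed_sq_def \<gamma>_def o_def bilinear_lzero)
    ultimately show ?thesis by (simp add: warped_speed_def)
  qed
  then have "warped_speed f \<gamma> UNIV = (\<lambda>_. \<bar>y - x\<bar>)" by blast
  then have "warped_length A \<sigma> f \<gamma> = \<bar>y - x\<bar>" unfolding warped_length_eq by simp
  ultimately show ?thesis by blast
qed

lemma horizontal_curve:
  assumes "chain (base_piece \<alpha>) 0 1" "z \<in> T" "0 \<le> f z"
  shows "joins T (\<lambda>t. (z, \<alpha> t)) (z, \<alpha> 0) (z, \<alpha> 1)"
    and "warped_length A \<sigma> f (\<lambda>t. (z, \<alpha> t)) = f z * riem_length \<alpha>"
  using assms lift_to_height by (auto simp: joins_def warped_length_eq warped_speed_lift[abs_def] riem_length_def)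

context
  fixes t0 t1 :: real and f :: "real \<Rightarrow> real"
  assumes conn: "connected_space X" and f: "admissible {t0..t1} f" and f0: "\<And>x. x \<in> {t0..t1} \<Longrightarrow> 0 < f x"
begin

abbreviation "M \<equiv> cylinder t0 t1 X"
abbreviation "d_f \<equiv> warped_dist t0 t1 X A \<sigma> f"

lemma warped_dist_eq:
  assumes "p \<in> M" "q \<in> M"
  shows "d_f p q = Inf {warped_length A \<sigma> f \<gamma> |\<gamma>. joins {t0..t1} \<gamma> p q}"
  using assms by (simp add: warped_dist_def piecewise_smooth_cylinder_curve_iff_chain joins_def)

lemma warped_dist_le: "p \<in> M \<Longrightarrow> q \<in> M \<Longrightarrow> joins {t0..t1} \<gamma> p q \<Longrightarrow> d_f p q \<le> warped_length A \<sigma> f \<gamma>"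
  unfolding warped_dist_eq by (intro cInf_lower bdd_belowI[of _ 0]) (auto intro: warped_length_nonneg[OF f])

lemma cylinder_joined:
  assumes "p \<in> M" "q \<in> M"
  shows "\<exists>\<gamma>. joins {t0..t1} \<gamma> p q"
proof -
  obtain x p' y q' where pq: "p = (x, p')" "q = (y, q')" by fastforce
  then have in_M: "x \<in> {t0..t1}" "y \<in> {t0..t1}" "p' \<in> topspace X" "q' \<in> topspace X"
    using assms by (auto simp: cylinder_def)
  obtain \<gamma> where \<gamma>: "joins {t0..t1} \<gamma> (x, p') (y, p')" using vertical_curve in_M by blast
  obtain \<alpha> where "chain (base_piece \<alpha>) 0 1" "\<alpha> 0 = p'" "\<alpha> 1 = q'"
    using points_joined_by_curve[OF conn] in_M by blast
  then have "joins {t0..t1} (\<lambda>t. (y, \<alpha> t)) (y, p') (y, q')"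
    using lift_to_height in_M by (auto simp: joins_def)
  then show ?thesis using joins_trans[OF \<gamma>] pq by blast
qed

lemma warped_dist_greatest:
  assumes "p \<in> M" "q \<in> M" "\<And>\<gamma>. joins {t0..t1} \<gamma> p q \<Longrightarrow> b \<le> warped_length A \<sigma> f \<gamma>"
  shows "b \<le> d_f p q"
  unfolding warped_dist_eq[OF assms(1,2)] using cylinder_joined[OF assms(1,2)] assms(3)
  by (intro cInf_greatest) auto

lemma warped_dist_approx:
  assumes "p \<in> M" "q \<in> M" "0 < \<epsilon>"
  shows "\<exists>\<gamma>. joins {t0..t1} \<gamma> p q \<and> warped_length A \<sigma> f \<gamma> < d_f p q + \<epsilon>"
  using warped_dist_greatest[OF assms(1,2), of "d_f p q + \<epsilon>"] assms(3) by force

lemma warped_dist_nonneg: "0 \<le> d_f p q"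
proof (cases "p \<in> M \<and> q \<in> M")
  case True
  then show ?thesis by (intro warped_dist_greatest warped_length_nonneg[OF f]) blast+
qed (auto simp: warped_dist_def)

lemma warped_dist_sym_le:
  assumes "p \<in> M" "q \<in> M"
  shows "d_f p q \<le> d_f q p"
proof (rule warped_dist_greatest[OF assms(2,1)])
  fix \<gamma> assume "joins {t0..t1} \<gamma> q p"
  then obtain \<eta> where "joins {t0..t1} \<eta> p q" "warped_length A \<sigma> f \<eta> = warped_length A \<sigma> f \<gamma>"
    using joins_reverse f by blast
  then show "d_f p q \<le> warped_length A \<sigma> f \<gamma>" using warped_dist_le[OF assms] by metis
qed

lemma warped_dist_triangle:
  assumes "p \<in> M" "q \<in> M" "r \<in> M"
  shows "d_f p r \<le> d_f p q + d_f q r"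
proof (rule field_le_epsilon)
  fix \<epsilon> :: real assume "0 < \<epsilon>"
  then obtain \<gamma>\<^sub>1 \<gamma>\<^sub>2 where \<gamma>: "joins {t0..t1} \<gamma>\<^sub>1 p q" "warped_length A \<sigma> f \<gamma>\<^sub>1 < d_f p q + \<epsilon> / 2"
      "joins {t0..t1} \<gamma>\<^sub>2 q r" "warped_length A \<sigma> f \<gamma>\<^sub>2 < d_f q r + \<epsilon> / 2"
    using warped_dist_approx[of p q "\<epsilon> / 2"] warped_dist_approx[of q r "\<epsilon> / 2"] assms by auto
  obtain \<eta> where "joins {t0..t1} \<eta> p r"
    "warped_length A \<sigma> f \<eta> = warped_length A \<sigma> f \<gamma>\<^sub>1 + warped_length A \<sigma> f \<gamma>\<^sub>2"
    using joins_trans[OF \<gamma>(1,3)] f by blast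
  then show "d_f p r \<le> d_f p q + d_f q r + \<epsilon>" using warped_dist_le[OF assms(1,3)] \<gamma>(2,4) by fastforce
qed

lemma warped_dist_vertical:
  assumes "x \<in> {t0..t1}" "y \<in> {t0..t1}" "p \<in> topspace X"
  shows "d_f (x, p) (y, p) \<le> \<bar>y - x\<bar>"
proof -
  obtain \<gamma> where "joins {t0..t1} \<gamma> (x, p) (y, p)" "warped_length A \<sigma> f \<gamma> = \<bar>y - x\<bar>"
    using vertical_curve[OF assms] by blast
  then show ?thesis using warped_dist_le[of "(x, p)" "(y, p)" \<gamma>] assms by (auto simp: cylinder_def)
qed

lemma warped_dist_horizontal:
  assumes "z \<in> {t0..t1}" "p \<in> topspace X" "q \<in> topspace X"
  shows "d_f (z, p) (z, q) \<le> f z * riem_dist X A \<sigma> p q"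
proof -
  have "d_f (z, p) (z, q) / f z \<le> riem_dist X A \<sigma> p q"
    unfolding riem_dist_eq[OF assms(2,3)]
  proof (rule cInf_greatest)
    show "{riem_length \<alpha> |\<alpha>. chain (base_piece \<alpha>) 0 1 \<and> \<alpha> 0 = p \<and> \<alpha> 1 = q} \<noteq> {}"
      using points_joined_by_curve[OF conn assms(2,3)] by blast
    fix b assume "b \<in> {riem_length \<alpha> |\<alpha>. chain (base_piece \<alpha>) 0 1 \<and> \<alpha> 0 = p \<and> \<alpha> 1 = q}"
    then obtain \<alpha> where \<alpha>: "chain (base_piece \<alpha>) 0 1" "\<alpha> 0 = p" "\<alpha> 1 = q" "b = riem_length \<alpha>" by blast
    have "d_f (z, p) (z, q) \<le> f z * b"
      using warped_dist_le[of "(z, p)" "(z, q)" "\<lambda>t. (z, \<alpha> t)"] horizontal_curve[of \<alpha> z "{t0..t1}" f] \<alpha> assms f0[OF assms(1)]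
      by (auto simp: cylinder_def)
    then show "d_f (z, p) (z, q) / f z \<le> b" using f0[OF assms(1)] by (simp add: field_simps)
  qed
  then show ?thesis using f0[OF assms(1)] by (simp add: field_simps)
qed

text \<open>
  The curve moves vertically to the height \<open>z\<close>, horizontally at this height, and vertically again.
\<close>

lemma warped_dist_via_level:
  assumes "x \<in> {t0..t1}" "y \<in> {t0..t1}" "z \<in> {t0..t1}" "p \<in> topspace X" "q \<in> topspace X"
  shows "d_f (x, p) (y, q) \<le> \<bar>x - z\<bar> + f z * riem_dist X A \<sigma> p q + \<bar>z - y\<bar>"
proof -
  have "d_f (x, p) (y, q) \<le> d_f (x, p) (z, p) + d_f (z, p) (y, q)"
    "d_f (z, p) (y, q) \<le> d_f (z, p) (z, q) + d_f (z, q) (y, q)"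
    using assms by (intro warped_dist_triangle; simp add: cylinder_def)+
  then show ?thesis
    using warped_dist_vertical[of x z p] warped_dist_vertical[of z y q] warped_dist_horizontal[of z p q] assms by simp
qed

text \<open>
  The height \<open>z\<close> is one at which \<open>f\<close> is small. Travelling to it and back costs \<open>2 \<delta>\<close> more than the
  direct vertical distance, and the factor \<open>sqrt 2\<close> compares the sum of two numbers with their
  Euclidean combination.
\<close>

lemma warped_dist_upper:
  assumes pq: "p \<in> M" "q \<in> M" and z: "z \<in> {t0..t1}" "\<bar>fst p - z\<bar> \<le> \<delta>" "f z \<le> C" and C: "1 \<le> C"
  shows "d_f p q \<le> sqrt 2 * C * ref_dist X A \<sigma> p q + 2 * \<delta>"
proof -
  obtain x p' y q' where eq: "p = (x, p')" "q = (y, q')" by fastforce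
  have in_M: "x \<in> {t0..t1}" "y \<in> {t0..t1}" "p' \<in> topspace X" "q' \<in> topspace X"
    using pq by (auto simp: cylinder_def eq)
  let ?r = "riem_dist X A \<sigma> p' q'"
  have r: "0 \<le> ?r" by (rule riem_dist_nonneg[OF conn])
  have "d_f p q \<le> \<bar>x - z\<bar> + f z * ?r + \<bar>z - y\<bar>"
    unfolding eq using in_M z(1) by (intro warped_dist_via_level)
  also have "\<dots> \<le> \<bar>x - y\<bar> + C * ?r + 2 * \<delta>"
    using z(2) mult_right_mono[OF z(3) r] by (simp add: eq)
  also have "\<bar>x - y\<bar> + C * ?r \<le> C * (\<bar>x - y\<bar> + ?r)" using C by (simp add: distrib_left mult_le_cancel_right1)
  also have "\<bar>x - y\<bar> + ?r \<le> sqrt 2 * sqrt (\<bar>x - y\<bar>\<^sup>2 + ?r\<^sup>2)"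
  proof -
    have "(\<bar>x - y\<bar> + ?r)\<^sup>2 \<le> 2 * (\<bar>x - y\<bar>\<^sup>2 + ?r\<^sup>2)"
      using sum_squares_ge_zero[of "\<bar>x - y\<bar> - ?r" 0] by (simp add: power2_eq_square algebra_simps)
    then show ?thesis by (simp add: real_sqrt_mult[symmetric] real_le_rsqrt)
  qed
  finally show ?thesis using C by (simp add: ref_dist_def prod_dist_def eq dist_real_def mult_ac)
qed

lemma warped_dist_lower:
  assumes pq: "p \<in> M" "q \<in> M" and c: "\<And>x. x \<in> {t0..t1} \<Longrightarrow> c \<le> f x" "0 < c" "c \<le> 1"
  shows "c * ref_dist X A \<sigma> p q \<le> d_f p q"
proof (rule warped_dist_greatest[OF pq])
  fix \<gamma> assume \<gamma>: "joins {t0..t1} \<gamma> p q"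
  have "chain (base_piece (snd \<circ> \<gamma>)) 0 1" using \<gamma> cylinder_chain_base by (auto simp: joins_def)
  from riem_dist_le[OF this] have "riem_dist X A \<sigma> (snd p) (snd q) \<le> riem_length (snd \<circ> \<gamma>)"
    using \<gamma> by (simp add: joins_def)
  then have "(riem_dist X A \<sigma> (snd p) (snd q))\<^sup>2 \<le> (riem_length (snd \<circ> \<gamma>))\<^sup>2"
    using riem_dist_nonneg[OF conn] by (intro power_mono)
  then have "ref_dist X A \<sigma> p q \<le> sqrt ((fst q - fst p)\<^sup>2 + (riem_length (snd \<circ> \<gamma>))\<^sup>2)"
    by (simp add: ref_dist_def prod_dist_def case_prod_unfold dist_real_def power2_commute)
  then have "c * ref_dist X A \<sigma> p q \<le> c * sqrt ((fst q - fst p)\<^sup>2 + (riem_length (snd \<circ> \<gamma>))\<^sup>2)"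
    using c(2) by simp
  also have "\<dots> \<le> warped_length A \<sigma> f \<gamma>" by (rule warped_length_lower_bound[OF f c(1) c(2,3) \<gamma>])
  finally show "c * ref_dist X A \<sigma> p q \<le> warped_length A \<sigma> f \<gamma>" .
qed

end

lemma ref_dist_pos:
  assumes "connected_space X" "p \<in> cylinder t0 t1 X" "q \<in> cylinder t0 t1 X" "p \<noteq> q"
  shows "0 < ref_dist X A \<sigma> p q"
proof -
  obtain x p' y q' where eq: "p = (x, p')" "q = (y, q')" by fastforce
  show ?thesis
  proof (cases "x = y")
    case True
    then have "0 < riem_dist X A \<sigma> p' q'" using riem_dist_pos assms by (auto simp: cylinder_def eq)
    then show ?thesis by (simp add: ref_dist_def prod_dist_def eq add_nonneg_pos)
  next
    case False
    then show ?thesis by (simp add: ref_dist_def prod_dist_def eq add_pos_nonneg)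
  qed
qed

text \<open>
  Separation of points comes from the comparison with the reference distance, the other axioms from
  reversal and concatenation of curves.
\<close>

lemma warped_dist_metric:
  assumes conn: "connected_space X" and f: "admissible {t0..t1} f"
    and c: "\<And>x. x \<in> {t0..t1} \<Longrightarrow> c \<le> f x" "0 < c" "c \<le> 1"
  shows "Metric_space (cylinder t0 t1 X) (warped_dist t0 t1 X A \<sigma> f)"
proof
  have f0: "\<And>x. x \<in> {t0..t1} \<Longrightarrow> 0 < f x" using c by force
  note facts = conn f f0
  fix p q
  show "0 \<le> warped_dist t0 t1 X A \<sigma> f p q" by (rule warped_dist_nonneg[OF facts])
  show "warped_dist t0 t1 X A \<sigma> f p q = warped_dist t0 t1 X A \<sigma> f q p"
  proof (cases "p \<in> cylinder t0 t1 X \<and> q \<in> cylinder t0 t1 X")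
    case True
    then show ?thesis using warped_dist_sym_le[OF facts] by (intro antisym) auto
  qed (auto simp: warped_dist_def)
  show "warped_dist t0 t1 X A \<sigma> f p q = 0 \<longleftrightarrow> p = q"
    if pq: "p \<in> cylinder t0 t1 X" "q \<in> cylinder t0 t1 X"
  proof
    assume 0: "warped_dist t0 t1 X A \<sigma> f p q = 0"
    then have "c * ref_dist X A \<sigma> p q \<le> 0" using warped_dist_lower[OF facts pq c] by simp
    then show "p = q" using ref_dist_pos[OF conn pq] c(2) by (meson mult_pos_pos not_le)
  next
    assume "p = q"
    moreover have "warped_dist t0 t1 X A \<sigma> f p p \<le> 0"
      using warped_dist_vertical[OF facts, of "fst p" "fst p" "snd p"] pq by (auto simp: cylinder_def)
    ultimately show "warped_dist t0 t1 X A \<sigma> f p q = 0" using warped_dist_nonneg[OF facts, of p p] by simp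
  qed
  fix r
  show "warped_dist t0 t1 X A \<sigma> f p r \<le> warped_dist t0 t1 X A \<sigma> f p q + warped_dist t0 t1 X A \<sigma> f q r"
    if "p \<in> cylinder t0 t1 X" "q \<in> cylinder t0 t1 X" "r \<in> cylinder t0 t1 X"
    using warped_dist_triangle[OF facts that] .
qed

text \<open>
  A product of finite nets: compactness of \<open>X\<close> is applied to open neighbourhoods of small Riemannian
  radius.
\<close>

lemma ref_dist_totally_bounded:
  assumes comp: "compact_space X" and conn: "connected_space X" and "0 < \<epsilon>"
  shows "\<exists>F. finite F \<and> F \<subseteq> cylinder t0 t1 X \<and>
    (\<forall>p\<in>cylinder t0 t1 X. \<exists>q\<in>F. ref_dist X A \<sigma> q p < \<epsilon>)"
proof -
  define \<eta> where "\<eta> = \<epsilon> / 2"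
  have \<eta>: "0 < \<eta>" using assms(3) by (simp add: \<eta>_def)
  have "\<forall>p\<in>topspace X. \<exists>N. openin X N \<and> p \<in> N \<and> (\<forall>q\<in>N. riem_dist X A \<sigma> p q < \<eta>)"
  proof
    fix p assume "p \<in> topspace X"
    then obtain N where N: "openin X N" "p \<in> N"
      "\<forall>q\<in>N. \<exists>\<alpha>. chain (base_piece \<alpha>) 0 1 \<and> \<alpha> 0 = p \<and> \<alpha> 1 = q \<and> riem_length \<alpha> < \<eta>"
      using nearby_points[OF _ \<eta>] by blast
    have "riem_dist X A \<sigma> p q < \<eta>" if "q \<in> N" for q
      using N(3) riem_dist_le that by fastforce
    then show "\<exists>N. openin X N \<and> p \<in> N \<and> (\<forall>q\<in>N. riem_dist X A \<sigma> p q < \<eta>)" using N by blast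
  qed
  then obtain N where N: "\<And>p. p \<in> topspace X \<Longrightarrow> openin X (N p) \<and> p \<in> N p \<and> (\<forall>q\<in>N p. riem_dist X A \<sigma> p q < \<eta>)"
    by metis
  have "\<exists>\<F>. finite \<F> \<and> \<F> \<subseteq> N ` topspace X \<and> topspace X \<subseteq> \<Union>\<F>"
  proof -
    have "\<forall>V\<in>N ` topspace X. openin X V" "topspace X \<subseteq> \<Union>(N ` topspace X)" using N by auto
    then show ?thesis using comp[unfolded compact_space_alt, rule_format, of "N ` topspace X"] by blast
  qed
  then obtain \<F> where \<F>: "finite \<F>" "\<F> \<subseteq> N ` topspace X" "topspace X \<subseteq> \<Union>\<F>" by blast
  obtain P where P: "P \<subseteq> topspace X" "finite P" "\<F> = N ` P"
    using finite_subset_image[OF \<F>(1,2)] by blast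
  have cover: "topspace X \<subseteq> (\<Union>p\<in>P. N p)" using \<F>(3) P(3) by simp
  obtain I where I: "finite I" "I \<subseteq> {t0..t1}" "{t0..t1} \<subseteq> (\<Union>x\<in>I. ball x \<eta>)"
    using compactE_image[of "{t0..t1}" "{t0..t1}" "\<lambda>x. ball x \<eta>"] \<eta> by force
  have "\<exists>q\<in>I \<times> P. ref_dist X A \<sigma> q (x, p) < \<epsilon>" if xp: "(x, p) \<in> cylinder t0 t1 X" for x p
  proof -
    obtain y where y: "y \<in> I" "dist y x < \<eta>" using I(3) xp by (force simp: cylinder_def)
    obtain q where q: "q \<in> P" "p \<in> N q" using cover xp by (force simp: cylinder_def)
    then have qp: "riem_dist X A \<sigma> q p < \<eta>" using N P(1) by blast
    have "ref_dist X A \<sigma> (y, q) (x, p) \<le> dist y x + riem_dist X A \<sigma> q p"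
      using riem_dist_nonneg[OF conn] by (simp add: ref_dist_def prod_dist_def sqrt_sum_squares_le_sum)
    also have "\<dots> < \<epsilon>" using y(2) qp by (simp add: \<eta>_def)
    finally show ?thesis using y(1) q(1) by blast
  qed
  moreover have "I \<times> P \<subseteq> cylinder t0 t1 X" using I P by (auto simp: cylinder_def)
  ultimately show ?thesis using I(1) P(2) by (intro exI[of _ "I \<times> P"]) auto
qed

end

section \<open>Subsequences of almost Lipschitz distances\<close>

text \<open>
  This is a version of the Arzela-Ascoli theorem for metrics. The triangle inequality turns the upper
  bound by \<open>e\<close> into equicontinuity up to an error \<open>2 \<delta> n\<close>, and since \<open>\<delta>\<close> tends to 0, convergence at
  the pairs of points of a finite net is enough for a uniform Cauchy condition.
\<close>

lemma almost_lipschitz_subsequence: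
  fixes d :: "nat \<Rightarrow> 'm \<Rightarrow> 'm \<Rightarrow> real" and e :: "'m \<Rightarrow> 'm \<Rightarrow> real"
  assumes metric: "\<And>n. Metric_space M (d n)"
    and lower: "\<And>n p q. p \<in> M \<Longrightarrow> q \<in> M \<Longrightarrow> c * e p q \<le> d n p q"
    and upper: "\<And>n p q. p \<in> M \<Longrightarrow> q \<in> M \<Longrightarrow> d n p q \<le> B * e p q + \<delta> n"
    and cB: "0 < c" "0 \<le> B" and \<delta>: "\<delta> \<longlonglongrightarrow> 0"
    and e_pos: "\<And>p q. p \<in> M \<Longrightarrow> q \<in> M \<Longrightarrow> p \<noteq> q \<Longrightarrow> 0 < e p q"
    and net: "\<And>\<epsilon>. 0 < \<epsilon> \<Longrightarrow> \<exists>F. finite F \<and> F \<subseteq> M \<and> (\<forall>p\<in>M. \<exists>q\<in>F. e q p < \<epsilon>)"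
  shows "\<exists>(r :: nat \<Rightarrow> nat) d_inf. strict_mono r \<and> Metric_space M d_inf \<and>
    uniform_limit (M \<times> M) (\<lambda>j (p, q). d (r j) p q) (\<lambda>(p, q). d_inf p q) sequentially \<and>
    (\<forall>p\<in>M. \<forall>q\<in>M. c * e p q \<le> d_inf p q \<and> d_inf p q \<le> B * e p q)"
proof -
  obtain F where F: "\<And>\<epsilon>. 0 < \<epsilon> \<Longrightarrow> finite (F \<epsilon>) \<and> F \<epsilon> \<subseteq> M \<and> (\<forall>p\<in>M. \<exists>q\<in>F \<epsilon>. e q p < \<epsilon>)"
    using net by metis
  define D where "D = (\<Union>k. F (1 / real (Suc k)))"
  have Fk: "finite (F (1 / real (Suc k)))" "F (1 / real (Suc k)) \<subseteq> M" for k using F by auto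
  have D: "countable D" "D \<subseteq> M"
    unfolding D_def using Fk(2) by (blast intro: countable_UN countable_finite[OF Fk(1)] countableI_type)+
  obtain K where K: "\<And>n. \<bar>\<delta> n\<bar> \<le> K" 
    using Bseq_eq_bounded convergent_imp_Bseq[OF convergentI[OF \<delta>]] by (metis BseqE real_norm_def)
  \<comment> \<open>a bound that is independent of \<open>n\<close>; dividing by it makes the sequence uniformly bounded\<close>
  define b where "b x = 1 + B * \<bar>e (fst x) (snd x)\<bar> + K" for x
  have K0: "0 \<le> K" using K[of 0] by simp
  have b: "0 < b x" for x using cB(2) K0 by (simp add: b_def add_pos_nonneg)
  have d_le: "\<bar>d n p q\<bar> \<le> b (p, q)" if "p \<in> M" "q \<in> M" for n p q
  proof -
    have "0 \<le> d n p q" using Metric_space.nonneg[OF metric] .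
    moreover have "B * e p q \<le> B * \<bar>e p q\<bar>" using cB(2) by (intro mult_left_mono) auto
    ultimately show ?thesis using upper[OF that, of n] K[of n] by (simp add: b_def)
  qed
  have scaled: "norm ((case x of (p, q) \<Rightarrow> d n p q) / b x) \<le> 1" if "x \<in> D \<times> D" for n x
    using that d_le D(2) b[of x] by (auto simp: field_simps subset_iff)
  obtain r :: "nat \<Rightarrow> nat" where r: "strict_mono r"
    "\<And>x. x \<in> D \<times> D \<Longrightarrow> \<exists>l. (\<lambda>n. (case x of (p, q) \<Rightarrow> d (r n) p q) / b x) \<longlonglongrightarrow> l"
    using function_convergent_subsequence[of "D \<times> D" "\<lambda>n x. (case x of (p, q) \<Rightarrow> d n p q) / b x" 1] scaled D(1)
    by auto
  have conv: "Cauchy (\<lambda>n. d (r n) p q)" if pq: "p \<in> D" "q \<in> D" for p q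
  proof -
    obtain l where "(\<lambda>n. d (r n) p q / b (p, q)) \<longlonglongrightarrow> l" using r(2)[of "(p, q)"] pq by auto
    then have "(\<lambda>n. d (r n) p q / b (p, q) * b (p, q)) \<longlonglongrightarrow> l * b (p, q)" by (intro tendsto_intros)
    then show ?thesis using b[of "(p, q)"] by (auto intro!: LIMSEQ_imp_Cauchy)
  qed
  have \<delta>r: "(\<lambda>j. \<delta> (r j)) \<longlonglongrightarrow> 0" using LIMSEQ_subseq_LIMSEQ[OF \<delta> r(1)] by (simp add: o_def)
  have close: "\<bar>d n p q - d n p' q'\<bar> \<le> B * (e p' p + e q' q) + 2 * \<delta> n"
    if in_M: "p \<in> M" "q \<in> M" "p' \<in> M" "q' \<in> M" for n p q p' q'
  proof -
    interpret Metric_space M "d n" by (rule metric)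
    have "d n p q \<le> d n p' p + d n p' q' + d n q' q"
      using triangle[of p p' q] triangle[of p' q' q] commute[of p p'] in_M by simp
    moreover have "d n p' q' \<le> d n p' p + d n p q + d n q' q"
      using triangle[of p' p q'] triangle[of p q q'] commute[of q q'] in_M by simp
    moreover have "d n p' p \<le> B * e p' p + \<delta> n" "d n q' q \<le> B * e q' q + \<delta> n"
      using upper in_M by auto
    ultimately show ?thesis by (simp add: distrib_left abs_le_iff)
  qed
  have "uniformly_Cauchy_on (M \<times> M) (\<lambda>j (p, q). d (r j) p q)"
    unfolding uniformly_Cauchy_on_def
  proof (intro allI impI)
    fix \<epsilon> :: real assume \<epsilon>: "0 < \<epsilon>"
    \<comment> \<open>two comparisons with the net, each costing at most \<open>2 B \<eta> + 2 \<delta>\<close>, together cost at most \<open>\<epsilon> / 2\<close>\<close>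
    define \<eta> where "\<eta> = \<epsilon> / (16 * (B + 1))"
    have \<eta>: "0 < \<eta>" using \<epsilon> cB(2) by (simp add: \<eta>_def)
    have B\<eta>: "B * \<eta> \<le> \<epsilon> / 16" using \<epsilon> cB(2) by (simp add: \<eta>_def field_simps)
    obtain k where k: "1 / real (Suc k) < \<eta>" using \<eta> nat_approx_posE by (metis of_nat_Suc)
    let ?F = "F (1 / real (Suc k))"
    have Fk: "finite ?F" "?F \<subseteq> M" "?F \<subseteq> D" "\<And>p. p \<in> M \<Longrightarrow> \<exists>p'\<in>?F. e p' p < 1 / real (Suc k)"
      using F[of "1 / real (Suc k)"] by (auto simp: D_def)
    have "\<forall>x\<in>?F \<times> ?F. \<exists>N. \<forall>m\<ge>N. \<forall>n\<ge>N. \<bar>d (r m) (fst x) (snd x) - d (r n) (fst x) (snd x)\<bar> < \<epsilon> / 4"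
    proof
      fix x assume "x \<in> ?F \<times> ?F"
      then have "Cauchy (\<lambda>n. d (r n) (fst x) (snd x))" using Fk(3) by (intro conv) (auto simp: mem_Times_iff simp del: of_nat_Suc)
      then show "\<exists>N. \<forall>m\<ge>N. \<forall>n\<ge>N. \<bar>d (r m) (fst x) (snd x) - d (r n) (fst x) (snd x)\<bar> < \<epsilon> / 4"
        using \<epsilon> unfolding Cauchy_def dist_real_def by (meson divide_pos_pos zero_less_numeral)
    qed
    then obtain N where N: "\<And>x m n. x \<in> ?F \<times> ?F \<Longrightarrow> N x \<le> m \<Longrightarrow> N x \<le> n \<Longrightarrow>
        \<bar>d (r m) (fst x) (snd x) - d (r n) (fst x) (snd x)\<bar> < \<epsilon> / 4"
      by metis
    obtain N' where N': "\<And>n. N' \<le> n \<Longrightarrow> \<delta> (r n) < \<epsilon> / 16"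
      using order_tendstoD(2)[OF \<delta>r, of "\<epsilon> / 16"] \<epsilon> by (auto simp: eventually_sequentially)
    define N0 where "N0 = Max (insert N' (N ` (?F \<times> ?F)))"
    have N0: "N' \<le> N0" "\<And>x. x \<in> ?F \<times> ?F \<Longrightarrow> N x \<le> N0"
      unfolding N0_def using Fk(1) by (auto intro!: Max_ge)
    have "\<bar>d (r m) p q - d (r n) p q\<bar> < \<epsilon>" if pq: "p \<in> M" "q \<in> M" and mn: "N0 \<le> m" "N0 \<le> n" for p q m n
    proof -
      obtain p' q' where p': "p' \<in> ?F" "e p' p < \<eta>" and q': "q' \<in> ?F" "e q' q < \<eta>"
        using Fk(4)[OF pq(1)] Fk(4)[OF pq(2)] k by (meson order.strict_trans)
      have "B * (e p' p + e q' q) \<le> B * (\<eta> + \<eta>)" using cB(2) p' q' by (intro mult_left_mono) auto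
      then have Be: "B * (e p' p + e q' q) \<le> \<epsilon> / 8" using B\<eta> by (simp add: distrib_left)
      have "\<bar>d (r m) p' q' - d (r n) p' q'\<bar> < \<epsilon> / 4"
        using N[of "(p', q')" m n] N0(2)[of "(p', q')"] p' q' mn by simp
      moreover have "\<bar>d (r m) p q - d (r m) p' q'\<bar> \<le> B * (e p' p + e q' q) + 2 * \<delta> (r m)"
        "\<bar>d (r n) p q - d (r n) p' q'\<bar> \<le> B * (e p' p + e q' q) + 2 * \<delta> (r n)"
        using close pq p' q' Fk(2) by blast+
      moreover have "\<delta> (r m) < \<epsilon> / 16" "\<delta> (r n) < \<epsilon> / 16" using N' N0(1) mn by auto
      ultimately show ?thesis using Be by linarith
    qed
    then show "\<exists>N0. \<forall>x\<in>M \<times> M. \<forall>m\<ge>N0. \<forall>n\<ge>N0.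
        dist (case x of (p, q) \<Rightarrow> d (r m) p q) (case x of (p, q) \<Rightarrow> d (r n) p q) < \<epsilon>"
      by (intro exI[of _ N0]) (auto simp: dist_real_def)
  qed
  then obtain l where l: "uniform_limit (M \<times> M) (\<lambda>j (p, q). d (r j) p q) l sequentially"
    using Cauchy_uniformly_convergent uniformly_convergent_on_def by blast
  define d_inf where "d_inf p q = (if p \<in> M \<and> q \<in> M then l (p, q) else 0)" for p q
  have lim: "(\<lambda>j. d (r j) p q) \<longlonglongrightarrow> d_inf p q" if "p \<in> M" "q \<in> M" for p q
    using tendsto_uniform_limitI[OF l, of "(p, q)"] that by (simp add: d_inf_def)
  have bounds: "c * e p q \<le> d_inf p q" "d_inf p q \<le> B * e p q" if pq: "p \<in> M" "q \<in> M" for p q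
  proof -
    show "c * e p q \<le> d_inf p q"
      using lower[OF pq] by (intro LIMSEQ_le_const[OF lim[OF pq]]) auto
    have "(\<lambda>j. B * e p q + \<delta> (r j)) \<longlonglongrightarrow> B * e p q + 0" by (intro tendsto_intros \<delta>r)
    then show "d_inf p q \<le> B * e p q"
      using upper[OF pq] by (intro LIMSEQ_le[OF lim[OF pq]]) auto
  qed
  have "Metric_space M d_inf"
  proof
    fix p q s
    show "0 \<le> d_inf p q"
    proof (cases "p \<in> M \<and> q \<in> M")
      case True
      then show ?thesis using Metric_space.nonneg[OF metric] by (intro LIMSEQ_le_const[OF lim]) auto
    qed (auto simp: d_inf_def)
    show "d_inf p q = d_inf q p"
    proof (cases "p \<in> M \<and> q \<in> M")
      case True
      then have "(\<lambda>j. d (r j) p q) \<longlonglongrightarrow> d_inf q p"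
        using lim[of q p] Metric_space.commute[OF metric, of _ p q] by simp
      then show ?thesis using lim[of p q] True LIMSEQ_unique by blast
    qed (auto simp: d_inf_def)
    show "d_inf p q = 0 \<longleftrightarrow> p = q" if pq: "p \<in> M" "q \<in> M"
    proof
      assume "d_inf p q = 0"
      then have "c * e p q \<le> 0" using bounds(1)[OF pq] by simp
      then show "p = q" using e_pos[OF pq] cB(1) by (meson mult_pos_pos not_le)
    next
      assume "p = q"
      then have "(\<lambda>j. 0) \<longlonglongrightarrow> d_inf p q" using lim[OF pq] Metric_space.zero[OF metric pq] by simp
      then show "d_inf p q = 0" by (simp add: LIMSEQ_const_iff)
    qed
    show "d_inf p s \<le> d_inf p q + d_inf q s" if "p \<in> M" "q \<in> M" "s \<in> M"
      using Metric_space.triangle[OF metric that]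
      by (intro LIMSEQ_le[OF lim[OF that(1,3)] tendsto_add[OF lim[OF that(1,2)] lim[OF that(2,3)]]]) auto
  qed
  moreover have "uniform_limit (M \<times> M) (\<lambda>j (p, q). d (r j) p q) (\<lambda>(p, q). d_inf p q) sequentially"
    using l by (rule uniform_limit_cong'[THEN iffD1, rotated -1]) (auto simp: d_inf_def)
  ultimately show ?thesis using r(1) bounds by blast
qed

lemma mtopology_mono_of_lipschitz:
  assumes d: "Metric_space M d" "Metric_space M d'"
    and K: "0 < K" "\<And>p q. p \<in> M \<Longrightarrow> q \<in> M \<Longrightarrow> d p q \<le> K * d' p q"
    and U: "openin (Metric_space.mtopology M d) U"
  shows "openin (Metric_space.mtopology M d') U"
proof -
  interpret d: Metric_space M d by (rule d)
  interpret d': Metric_space M d' by (rule d)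
  have U: "U \<subseteq> M" "\<And>x. x \<in> U \<Longrightarrow> \<exists>r>0. d.mball x r \<subseteq> U" using U d.openin_mtopology by auto
  have "\<exists>r>0. d'.mball x r \<subseteq> U" if x: "x \<in> U" for x
  proof -
    obtain r where r: "0 < r" "d.mball x r \<subseteq> U" using U(2)[OF x] by blast
    have "d'.mball x (r / K) \<subseteq> d.mball x r"
    proof
      fix y assume y: "y \<in> d'.mball x (r / K)"
      then have "K * d' x y < r" using K(1) by (simp add: field_simps)
      then show "y \<in> d.mball x r" using K(2)[of x y] y by auto
    qed
    then show ?thesis using r K(1) by (intro exI[of _ "r / K"]) auto
  qed
  then show ?thesis using U(1) d'.openin_mtopology by blast
qed

lemma mtopology_eq_of_bilipschitz:
  assumes "Metric_space M d" "Metric_space M d'"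
    and "0 < K" "\<And>p q. p \<in> M \<Longrightarrow> q \<in> M \<Longrightarrow> d p q \<le> K * d' p q"
    and "0 < K'" "\<And>p q. p \<in> M \<Longrightarrow> q \<in> M \<Longrightarrow> d' p q \<le> K' * d p q"
  shows "Metric_space.mtopology M d = Metric_space.mtopology M d'"
  unfolding topology_eq using mtopology_mono_of_lipschitz assms by metis

section \<open>Uniform limits of warped distances\<close>

theorem theorem1p3:
  fixes t0 t1 c C :: real
    and X :: "'a topology"
    and A :: "('a, 'b::real_inner) chart set"
    and \<sigma> :: "('a, 'b) chart \<Rightarrow> 'a \<Rightarrow> 'b \<Rightarrow> 'b \<Rightarrow> real"
    and f :: "nat \<Rightarrow> real \<Rightarrow> real"
    and \<delta> :: "nat \<Rightarrow> real"
    and Q :: "nat \<Rightarrow> real set"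
  assumes "t0 < t1"
    and "riemannian_manifold X A \<sigma>" and "compact_space X" and "connected_space X"
    and "0 < c" and "c < 1" and "1 \<le> C"
    and f_pos: "\<And>n x. x \<in> {t0..t1} \<Longrightarrow> 0 < f n x"
    and f_bounded: "\<And>n. bounded (f n ` {t0..t1})"
    and f_measurable: "\<And>n. f n \<in> borel_measurable (restrict_space borel {t0..t1})"
    and \<delta>_pos: "\<And>n. 0 < \<delta> n" and \<delta>_lim: "\<delta> \<longlonglongrightarrow> 0"
    and dense: "dense_countable_family t0 t1 \<delta> Q"
    and f_upper: "\<And>n q. q \<in> Q n \<Longrightarrow> f n q \<le> C"
    and f_lower: "\<And>n x. x \<in> {t0..t1} \<Longrightarrow> c \<le> f n x"
  shows "(\<forall>n. Metric_space (cylinder t0 t1 X) (warped_dist t0 t1 X A \<sigma> (f n)) \<and>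
           (\<forall>p\<in>cylinder t0 t1 X. \<forall>q\<in>cylinder t0 t1 X.
              c * ref_dist X A \<sigma> p q \<le> warped_dist t0 t1 X A \<sigma> (f n) p q \<and>
              warped_dist t0 t1 X A \<sigma> (f n) p q \<le> sqrt 2 * C * ref_dist X A \<sigma> p q + 2 * \<delta> n)) \<and>
         (\<exists>(r :: nat \<Rightarrow> nat) d_inf.
           strict_mono r \<and>
           Metric_space (cylinder t0 t1 X) d_inf \<and>
           uniform_limit (cylinder t0 t1 X \<times> cylinder t0 t1 X)
             (\<lambda>j (p, q). warped_dist t0 t1 X A \<sigma> (f (r j)) p q) (\<lambda>(p, q). d_inf p q) sequentially \<and>
           (\<forall>n. Metric_space.mtopology (cylinder t0 t1 X) d_inf =
                Metric_space.mtopology (cylinder t0 t1 X) (warped_dist t0 t1 X A \<sigma> (f n))) \<and>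
           (\<forall>p\<in>cylinder t0 t1 X. \<forall>q\<in>cylinder t0 t1 X.
              c * ref_dist X A \<sigma> p q \<le> d_inf p q \<and>
              d_inf p q \<le> sqrt 2 * C * ref_dist X A \<sigma> p q))"
proof -
  interpret riemannian_manifold X A \<sigma> by fact
  let ?M = "cylinder t0 t1 X" and ?e = "ref_dist X A \<sigma>" and ?d = "\<lambda>n. warped_dist t0 t1 X A \<sigma> (f n)"
  note conn = \<open>connected_space X\<close>
  have adm: "admissible {t0..t1} (f n)" for n using f_measurable f_bounded by (simp add: admissible_def)
  have c: "0 < c" "c \<le> 1" using assms by auto
  have metric: "Metric_space ?M (?d n)" for n
    by (rule warped_dist_metric[OF conn adm f_lower c])
  have lower: "c * ?e p q \<le> ?d n p q" if "p \<in> ?M" "q \<in> ?M" for n p q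
    by (rule warped_dist_lower[OF conn adm f_pos that f_lower c])
  have upper: "?d n p q \<le> sqrt 2 * C * ?e p q + 2 * \<delta> n" if pq: "p \<in> ?M" "q \<in> ?M" for n p q
  proof -
    have "fst p \<in> {t0..t1}" using pq by (auto simp: cylinder_def)
    then obtain z where z: "z \<in> Q n" "\<bar>fst p - z\<bar> \<le> \<delta> n" "z \<in> {t0..t1}"
      using dense unfolding dense_countable_family_def by blast
    show ?thesis by (rule warped_dist_upper[OF conn adm f_pos pq z(3,2) f_upper[OF z(1)] \<open>1 \<le> C\<close>])
  qed
  \<comment> \<open>with \<open>z\<close> the height of \<open>p\<close> itself there is no detour and no additive error, but \<open>C\<close> is replaced by a bound of \<open>f n\<close>\<close>
  have lipschitz: "\<exists>K>0. \<forall>p\<in>?M. \<forall>q\<in>?M. ?d n p q \<le> K * ?e p q" for n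
  proof -
    obtain K where K: "\<And>x. x \<in> {t0..t1} \<Longrightarrow> f n x \<le> K"
      using bounded_imp_bdd_above[OF f_bounded[of n]] unfolding bdd_above.unfold by blast
    have "?d n p q \<le> sqrt 2 * max 1 K * ?e p q" if pq: "p \<in> ?M" "q \<in> ?M" for p q
    proof -
      have x: "fst p \<in> {t0..t1}" using pq by (auto simp: cylinder_def)
      have "f n (fst p) \<le> max 1 K" using K[OF x] by simp
      then show ?thesis using warped_dist_upper[OF conn adm f_pos pq x, of 0 n "max 1 K"] by simp
    qed
    then show ?thesis by (intro exI[of _ "sqrt 2 * max 1 K"]) auto
  qed
  have "(\<lambda>n. 2 * \<delta> n) \<longlonglongrightarrow> 0" using tendsto_mult_left[OF \<delta>_lim, of 2] by simp
  note almost_lipschitz_subsequence[OF metric lower upper c(1) _ this ref_dist_pos[OF conn]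
      ref_dist_totally_bounded[OF \<open>compact_space X\<close> conn]]
  then have "\<exists>(r :: nat \<Rightarrow> nat) d_inf. strict_mono r \<and> Metric_space ?M d_inf \<and>
      uniform_limit (?M \<times> ?M) (\<lambda>j (p, q). ?d (r j) p q) (\<lambda>(p, q). d_inf p q) sequentially \<and>
      (\<forall>p\<in>?M. \<forall>q\<in>?M. c * ?e p q \<le> d_inf p q \<and> d_inf p q \<le> sqrt 2 * C * ?e p q)"
    using \<open>1 \<le> C\<close> by simp
  then obtain r d_inf where r: "strict_mono (r :: nat \<Rightarrow> nat)" and d_inf: "Metric_space ?M d_inf"
    and limit: "uniform_limit (?M \<times> ?M) (\<lambda>j (p, q). ?d (r j) p q) (\<lambda>(p, q). d_inf p q) sequentially"
    and bounds: "\<And>p q. p \<in> ?M \<Longrightarrow> q \<in> ?M \<Longrightarrow> c * ?e p q \<le> d_inf p q \<and> d_inf p q \<le> sqrt 2 * C * ?e p q"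
    by blast
  have "Metric_space.mtopology ?M d_inf = Metric_space.mtopology ?M (?d n)" for n
  proof -
    obtain K where K: "0 < K" "\<And>p q. p \<in> ?M \<Longrightarrow> q \<in> ?M \<Longrightarrow> ?d n p q \<le> K * ?e p q"
      using lipschitz by blast
    show ?thesis
    proof (rule mtopology_eq_of_bilipschitz[OF d_inf metric])
      show "0 < sqrt 2 * C / c" "0 < K / c" using c(1) K(1) \<open>1 \<le> C\<close> by auto
      fix p q assume pq: "p \<in> ?M" "q \<in> ?M"
      have "?e p q \<le> ?d n p q / c" using lower[OF pq, of n] c(1) by (simp add: field_simps)
      then have "sqrt 2 * C * ?e p q \<le> sqrt 2 * C * (?d n p q / c)"
        using \<open>1 \<le> C\<close> by (intro mult_left_mono) auto
      then show "d_inf p q \<le> sqrt 2 * C / c * ?d n p q" using bounds[OF pq] by simp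
      have "?e p q \<le> d_inf p q / c" using bounds[OF pq] c(1) by (simp add: field_simps)
      then have "K * ?e p q \<le> K * (d_inf p q / c)" using K(1) by (intro mult_left_mono) auto
      then show "?d n p q \<le> K / c * d_inf p q" using K(2)[OF pq] by simp
    qed
  qed
  then show ?thesis using metric lower upper r d_inf limit bounds by blast
qed

end
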